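(* Let $p\ge 2$, let $(B,\sigma,\nu)$ be the standard uniform $p$-to-one endomorphism, let $(Z,d)$ be a compact metric space whose group of isometries $\mathcal I$ acts transitively, with $m$ the $\mathcal I$-invariant (Haar) Borel probability measure on $Z$, and let $f:B\to\mathcal I$ generate a summable cocycle. Suppose that the cocycle extension $T_f(b,z)=(\sigma(b),f(b)(z))$ on $(B\times Z,\nu\times m)$ is weakly mixing. Then $T_f$ is tree very weak Bernoulli (tree v.w.B.).
   Context: Fix an integer $p\ge 2$. A uniform $p$-to-one endomorphism $(X,T,\mu)$ of a Lebesgue probability space (with $\sigma$-algebra $\mathcal F$) is a measure-preserving map of entropy $\log p$ that is a.e. $p$-to-one and such that, for a.e. $x$, the conditional expectation (given $x$) of each preimage of $x$ is $1/p$. The standard example is $(B,\sigma,\nu)$: $B=\{0,\dots,p-1\}^{\mathbb N}$, $\sigma(b)_i=b_{i+1}$, $\nu$ i.i.d. uniform. Trees. Let $\eta$ be the set of finite words over $\{0,\dots,p-1\}$ (nodes of the rooted $p$-ary tree), $|v|$ the length of $v$, $\eta_n=\{v:|v|\le n\}$, and $\mathcal A_n$ the group of bijections of $\eta_n$ preserving the tree structure (root, levels and edges). Given a measurable partition $\{K_0,\dots,K_{p-1}\}$ of $X$ such that a.e. $x$ has one preimage in each $K_i$, let $T_i(x)$ be the preimage of $x$ in $K_i$ and $T_v(x)=T_{v_n}(\cdots T_{v_1}(x))$ for $v=(v_1,\dots,v_n)$. For $(B,\sigma)$ the partial inverses are the natural ones, $\sigma_i(b)=(i,b_0,b_1,\dots)$,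 and $\sigma_v=\sigma_{v_n}\circ\cdots\circ\sigma_{v_1}$. Summable cocycle. $\mathcal I$ carries the uniform metric $\sup_{z}d(\phi(z),\psi(z))$. Set $c_m=\sup_{|v|=m}\mathrm{diam}(f(\sigma_v(B)))$. $f$ generates a summable cocycle if $\sum_m c_m<\infty$. Tree v.w.B. For a compact metric space $(R,d)$ of diameter $1$ and $g:X\to R$, the tree name of $x$ is $\mathcal T_x(v)=g(T_v(x))$, $v\in\eta$; $g$ is tree adapted if for a.e. $x$, $\mathcal T_x(vi)\neq\mathcal T_x(vj)$ for all $v$ and $i\ne j$; $g$ generates if $\bigvee_{i\ge 0}T^{-i}\mathcal G=\mathcal F$ mod null sets, $\mathcal G$ the $\sigma$-algebra generated by $g$. For names $h,h'$, $\overline t_n(h,h')=\min_{A\in\mathcal A_n}\frac1n\sum_{0<|v|\le n}p^{-|v|}d(h(v),h'(A(v)))$. For $g$ tree adapted, $(X,T,\mu)$ and $g$ are tree v.w.B. if for any $\varepsilon>0$ and all $N$ sufficiently large there is a set $G$ with $\mu(G)>1-\varepsilon$ such that $\overline t_N(\mathcal T_x,\mathcal T_y)<\varepsilon$ for all $x,y\in G$. An endomorphism $T$ is said to be tree v.w.B. (with no function mentioned) if it is tree v.w.B. with some generating tree adapted function. *)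

theory Defs
  imports "HOL-Probability.Probability"
begin

definition measure_preserving_map :: "'x measure \<Rightarrow> ('x \<Rightarrow> 'x) \<Rightarrow> bool" where
  "measure_preserving_map M T \<longleftrightarrow> T \<in> M \<rightarrow>\<^sub>M M \<and> distr M M T = M"

definition weakly_mixing :: "'x measure \<Rightarrow> ('x \<Rightarrow> 'x) \<Rightarrow> bool" where
  "weakly_mixing M T \<longleftrightarrow>
     (\<forall>A\<in>sets M. \<forall>C\<in>sets M.
        (\<lambda>n. (\<Sum>k<n. \<bar>measure M ((T ^^ k) -` A \<inter> C) - measure M A * measure M C\<bar>) / real n)
          \<longlonglongrightarrow> 0)"

text \<open>Finite measurable partitions are encoded as simple functions. The \<open>n\<close>-name
  of a point gives the common refinement of the partitions pulled back under the first \<open>n\<close>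
  iterates of \<open>T\<close>. The limit in the entropy rate exists by subadditivity; logarithms are
  natural.\<close>

definition itinerary :: "('x \<Rightarrow> 'x) \<Rightarrow> ('x \<Rightarrow> 'c) \<Rightarrow> nat \<Rightarrow> 'x \<Rightarrow> 'c list" where
  "itinerary T P n x = map (\<lambda>i. P ((T ^^ i) x)) [0..<n]"

definition partition_entropy :: "'x measure \<Rightarrow> ('x \<Rightarrow> 'c) \<Rightarrow> real" where
  "partition_entropy M P = prob_space.entropy M (exp 1) (count_space (P ` space M)) P"

definition entropy_rate :: "'x measure \<Rightarrow> ('x \<Rightarrow> 'x) \<Rightarrow> ('x \<Rightarrow> 'c) \<Rightarrow> real" where
  "entropy_rate M T P = lim (\<lambda>n. partition_entropy M (itinerary T P n) / real n)"

definition ks_entropy :: "'x measure \<Rightarrow> ('x \<Rightarrow> 'x) \<Rightarrow> ereal" where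
  "ks_entropy M T = (SUP P\<in>{P :: 'x \<Rightarrow> nat. simple_function M P}. ereal (entropy_rate M T P))"

text \<open>The last clause says that, conditionally on \<open>T y = x\<close>, the point \<open>y\<close> is uniformly
  distributed on the \<open>p\<close> preimages of \<open>x\<close>. That \<open>M\<close> be a Lebesgue space is a condition on \<open>M\<close>
  alone and is not part of this predicate; below it is only used for a product of Borel
  probability measures on compact metrizable spaces.\<close>

definition uniform_endomorphism :: "nat \<Rightarrow> 'x measure \<Rightarrow> ('x \<Rightarrow> 'x) \<Rightarrow> bool" where
  "uniform_endomorphism p M T \<longleftrightarrow>
     prob_space M \<and> measure_preserving_map M T \<and>
     ks_entropy M T = ereal (ln (real p)) \<and>
     (AE x in M. card {y \<in> space M. T y = x} = p) \<and>
     (\<forall>A\<in>sets M. AE x in M.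
        real_cond_exp M (vimage_algebra (space M) T M) (indicator A) x
          = real (card {y \<in> A. T y = T x}) / real p)"

definition words :: "nat \<Rightarrow> nat list set" where
  "words p = {v. set v \<subseteq> {..<p}}"

definition words_upto :: "nat \<Rightarrow> nat \<Rightarrow> nat list set" where
  "words_upto p n = {v \<in> words p. length v \<le> n}"

definition tree_edge :: "nat list \<Rightarrow> nat list \<Rightarrow> bool" where
  "tree_edge u v \<longleftrightarrow> (\<exists>i. v = u @ [i])"

definition tree_automorphisms :: "nat \<Rightarrow> nat \<Rightarrow> (nat list \<Rightarrow> nat list) set" where
  "tree_automorphisms p n =
     {A \<in> extensional (words_upto p n).
        bij_betw A (words_upto p n) (words_upto p n) \<and>
        A [] = [] \<and>
        (\<forall>v\<in>words_upto p n. length (A v) = length v) \<and>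
        (\<forall>u\<in>words_upto p n. \<forall>v\<in>words_upto p n. tree_edge u v \<longleftrightarrow> tree_edge (A u) (A v))}"

definition tbar :: "nat \<Rightarrow> nat \<Rightarrow> (nat list \<Rightarrow> 'r::metric_space) \<Rightarrow> (nat list \<Rightarrow> 'r) \<Rightarrow> real" where
  "tbar p n h h' =
     Min ((\<lambda>A. 1 / real n *
             (\<Sum>v | v \<in> words_upto p n \<and> 0 < length v.
                (1 / real p) ^ length v * dist (h v) (h' (A v))))
          ` tree_automorphisms p n)"

text \<open>\<open>branch S (v\<^sub>1, \<dots>, v\<^sub>n) = S\<^bsub>v\<^sub>n\<^esub> \<circ> \<dots> \<circ> S\<^bsub>v\<^sub>1\<^esub>\<close>: the first letter acts first.\<close>

definition branch :: "(nat \<Rightarrow> 'x \<Rightarrow> 'x) \<Rightarrow> nat list \<Rightarrow> 'x \<Rightarrow> 'x" where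
  "branch S v = fold S v"

definition preimage_partition ::
    "nat \<Rightarrow> 'x measure \<Rightarrow> ('x \<Rightarrow> 'x) \<Rightarrow> (nat \<Rightarrow> 'x set) \<Rightarrow> bool" where
  "preimage_partition p M T K \<longleftrightarrow>
     (\<forall>i<p. K i \<in> sets M) \<and> disjoint_family_on K {..<p} \<and> (\<Union>i<p. K i) = space M \<and>
     (AE x in M. \<forall>i<p. \<exists>!y. y \<in> K i \<and> T y = x)"

definition partial_inverse :: "('x \<Rightarrow> 'x) \<Rightarrow> (nat \<Rightarrow> 'x set) \<Rightarrow> nat \<Rightarrow> 'x \<Rightarrow> 'x" where
  "partial_inverse T K i x = (THE y. y \<in> K i \<and> T y = x)"

definition tree_name ::
    "('x \<Rightarrow> 'x) \<Rightarrow> (nat \<Rightarrow> 'x set) \<Rightarrow> ('x \<Rightarrow> 'r) \<Rightarrow> 'x \<Rightarrow> nat list \<Rightarrow> 'r" where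
  "tree_name T K g x v = g (branch (partial_inverse T K) v x)"

definition tree_adapted ::
    "nat \<Rightarrow> 'x measure \<Rightarrow> ('x \<Rightarrow> 'x) \<Rightarrow> (nat \<Rightarrow> 'x set) \<Rightarrow> ('x \<Rightarrow> 'r) \<Rightarrow> bool" where
  "tree_adapted p M T K g \<longleftrightarrow>
     (AE x in M. \<forall>v\<in>words p. \<forall>i<p. \<forall>j<p. i \<noteq> j \<longrightarrow>
        tree_name T K g x (v @ [i]) \<noteq> tree_name T K g x (v @ [j]))"

definition generating ::
    "'x measure \<Rightarrow> ('x \<Rightarrow> 'x) \<Rightarrow> ('x \<Rightarrow> 'r::topological_space) \<Rightarrow> bool" where
  "generating M T g \<longleftrightarrow>
     (\<forall>A\<in>sets M.
        \<exists>A'\<in>sigma_sets (space M)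
               {(\<lambda>x. g ((T ^^ i) x)) -` S \<inter> space M | i S. S \<in> sets borel}.
          (A - A') \<union> (A' - A) \<in> null_sets M)"

definition tree_vwB_with ::
    "nat \<Rightarrow> 'x measure \<Rightarrow> ('x \<Rightarrow> 'x) \<Rightarrow> (nat \<Rightarrow> 'x set) \<Rightarrow> ('x \<Rightarrow> 'r::metric_space) \<Rightarrow> bool" where
  "tree_vwB_with p M T K g \<longleftrightarrow>
     (\<forall>\<epsilon>>0. \<exists>N\<^sub>0. \<forall>N\<ge>N\<^sub>0. \<exists>G\<in>sets M.
        measure M G > 1 - \<epsilon> \<and>
        (\<forall>x\<in>G. \<forall>y\<in>G. tbar p N (tree_name T K g x) (tree_name T K g y) < \<epsilon>))"

text \<open>The target \<open>R\<close> of \<open>g\<close> ranges over all compact metric spaces. HOL cannot quantify over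
  types, so \<open>R\<close> is taken to be a compact subset of \<open>\<ell>\<^sup>\<infinity>\<close>, the type of bounded functions
  \<open>nat \<Rightarrow> real\<close> with the sup metric, into which every compact (indeed every separable) metric
  space embeds isometrically. Changing the partition \<open>K\<close> changes almost every tree name by an
  automorphism of the infinite tree only, so the choice of \<open>K\<close> is immaterial.\<close>

definition tree_vwB :: "nat \<Rightarrow> 'x measure \<Rightarrow> ('x \<Rightarrow> 'x) \<Rightarrow> bool" where
  "tree_vwB p M T \<longleftrightarrow>
     uniform_endomorphism p M T \<and>
     (\<exists>K (R :: (nat \<Rightarrow>\<^sub>C real) set) g.
        preimage_partition p M T K \<and>
        compact R \<and> diameter R = 1 \<and>
        g \<in> borel_measurable M \<and> g \<in> space M \<rightarrow> R \<and>
        tree_adapted p M T K g \<and> generating M T g \<and>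
        tree_vwB_with p M T K g)"

definition std_space :: "nat \<Rightarrow> (nat \<Rightarrow> nat) measure" where
  "std_space p = (\<Pi>\<^sub>M i\<in>UNIV. uniform_count_measure {..<p})"

definition std_shift :: "(nat \<Rightarrow> nat) \<Rightarrow> (nat \<Rightarrow> nat)" where
  "std_shift b = (\<lambda>i. b (Suc i))"

definition std_inverse :: "nat \<Rightarrow> (nat \<Rightarrow> nat) \<Rightarrow> (nat \<Rightarrow> nat)" where
  "std_inverse i b = case_nat i b"

definition isometries :: "('z::metric_space \<Rightarrow> 'z) set" where
  "isometries = {\<phi>. bij \<phi> \<and> (\<forall>z w. dist (\<phi> z) (\<phi> w) = dist z w)}"

definition uniform_dist :: "('z \<Rightarrow> 'z::metric_space) \<Rightarrow> ('z \<Rightarrow> 'z) \<Rightarrow> real" where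
  "uniform_dist \<phi> \<psi> = (SUP z. dist (\<phi> z) (\<psi> z))"

definition uniform_diameter :: "('z \<Rightarrow> 'z::metric_space) set \<Rightarrow> real" where
  "uniform_diameter \<Phi> = (SUP (\<phi>, \<psi>)\<in>\<Phi> \<times> \<Phi>. uniform_dist \<phi> \<psi>)"

definition cocycle_variation ::
    "nat \<Rightarrow> ((nat \<Rightarrow> nat) \<Rightarrow> 'z \<Rightarrow> 'z::metric_space) \<Rightarrow> nat \<Rightarrow> real" where
  "cocycle_variation p f k =
     (SUP v\<in>{v \<in> words p. length v = k}.
        uniform_diameter (f ` branch std_inverse v ` space (std_space p)))"

definition summable_cocycle ::
    "nat \<Rightarrow> ((nat \<Rightarrow> nat) \<Rightarrow> 'z \<Rightarrow> 'z::metric_space) \<Rightarrow> bool" where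
  "summable_cocycle p f \<longleftrightarrow> summable (cocycle_variation p f)"

definition cocycle_extension ::
    "((nat \<Rightarrow> nat) \<Rightarrow> 'z \<Rightarrow> 'z) \<Rightarrow> (nat \<Rightarrow> nat) \<times> 'z \<Rightarrow> (nat \<Rightarrow> nat) \<times> 'z" where
  "cocycle_extension f = (\<lambda>(b, z). (std_shift b, f b z))"

end

theory Submission
  imports Defs
begin

text \<open>The inverse branches of \<open>T\<^sub>f\<close> do not spread points apart: if two points agree in \<open>k\<close>
  symbols and their fibre coordinates are \<open>d\<close>-close, then along any common word the fibre
  coordinates stay within \<open>d + \<Sum>\<^bsub>j > k\<^esub> c\<^sub>j\<close>. Cover the space by finitely many small cells. Weak
  mixing yields one time \<open>r\<close> at which preimages of all cells meet a fixed small cell, so every point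
  has a branch of length \<open>r\<close> that ends in a fixed small set. For two points, a tree automorphism
  matching these two branches makes a proportion \<open>p\<^sup>-\<^sup>r\<close> of the pairs of nodes close for ever, and
  iterating on the remaining nodes makes the proportion of bad nodes decay geometrically,
  uniformly over all pairs of points.

  The entropy is at most \<open>ln p\<close> by the same contraction: \<open>n + k\<close> symbols and a cell of the fibre
  coordinate of \<open>T\<^sup>n x\<close> determine the orbit segment up to a small error, and a partition is
  approximated in \<open>L\<^sup>1\<close> by a uniformly continuous function.\<close>

section \<open>Entropy rates\<close>

text \<open>Tree automorphisms preserve levels, so two branches can be matched only if they have the
  same length. Ergodicity would give each cell a hitting time of its own; weak mixing supplies one
  time for all cells, and this is what makes the matching possible.

  The conclusion also asks that the extension be a uniform endomorphism of entropy exactly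
  \<open>ln p\<close>. The lower bound is read off the Bernoulli factor; a large fibre could in
  principle add entropy, and it is the isometric fibre maps that exclude this. The remaining
  measure-theoretic clauses all come from one identity: the measure of a set is the average of the
  measures of its pullbacks under the \<open>p\<close> inverse branches.

  The tree names are taken with respect to the pair of first symbol and fibre coordinate. To make
  this pair a point of a compact set of diameter exactly 1, \<open>p\<close> disjoint copies of Z
  are placed in the space of bounded sequences. The first symbol separates siblings, and injectivity
  on pairs makes the function generating.\<close>

lemma subadditive_quotient_convergent:
  fixes a :: "nat \<Rightarrow> real"
  assumes sub: "\<And>m n. a (m + n) \<le> a m + a n" and nonneg: "\<And>n. 0 \<le> a n"
  shows "convergent (\<lambda>n. a n / real n)"
proof -
  \<comment> \<open>This is Fekete's lemma: the limit is the infimum of the quotients.\<close>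
  define l where "l = (INF n\<in>{1..}. a n / real n)"
  have bdd: "bdd_below ((\<lambda>n. a n / real n) ` {1..})"
    using nonneg by (auto intro!: bdd_belowI2[where m = 0])
  have lower: "l \<le> a n / real n" if "n \<ge> 1" for n
    unfolding l_def using that by (intro cINF_lower[OF bdd]) auto
  have mult: "a (q * k + r) \<le> real q * a k + a r" for q k r
  proof (induction q)
    case (Suc q)
    have "a (Suc q * k + r) \<le> a k + a (q * k + r)"
      using sub[of k "q * k + r"] by (simp add: algebra_simps)
    with Suc show ?case by (simp add: algebra_simps)
  qed simp
  have "(\<lambda>n. a n / real n) \<longlonglongrightarrow> l"
  proof (rule LIMSEQ_I)
    fix e :: real assume e: "0 < e"
    have "\<exists>k\<in>{1..}. a k / real k < l + e / 2"
      using e cINF_less_iff[OF _ bdd, of "l + e / 2"] by (auto simp: l_def)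
    then obtain k where k: "k \<ge> 1" "a k / real k < l + e / 2" by auto
    \<comment> \<open>A bound for every remainder term \<open>a (n mod k)\<close>, independent of
      \<open>n\<close>, so that it vanishes after division by \<open>n\<close>.\<close>
    define C where "C = (\<Sum>r<k. a r)"
    have C: "a r \<le> C" if "r < k" for r
      unfolding C_def using that nonneg by (intro member_le_sum) auto
    have C0: "0 \<le> C" unfolding C_def using nonneg by (intro sum_nonneg) auto
    obtain n0 :: nat where n0: "2 * C / e < real n0" using reals_Archimedean2 by blast
    show "\<exists>no. \<forall>n\<ge>no. norm (a n / real n - l) < e"
    proof (intro exI[of _ "Suc n0"] allI impI)
      fix n assume n: "n \<ge> Suc n0"
      have "a n \<le> real (n div k) * a k + a (n mod k)"
        using mult[of "n div k" k "n mod k"] by simp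
      also have "\<dots> \<le> real n / real k * a k + C"
        using C[of "n mod k"] k nonneg
        by (intro add_mono mult_right_mono) (auto simp: of_nat_div_le_of_nat)
      finally have "a n / real n \<le> (real n / real k * a k + C) / real n"
        using n by (intro divide_right_mono) auto
      also have "\<dots> = a k / real k + C / real n"
        using n k by (simp add: field_simps)
      also have "\<dots> < l + e / 2 + e / 2"
      proof (intro add_strict_mono k)
        have "2 * C / e < real n" using n0 n by linarith
        then show "C / real n < e / 2" using e n by (simp add: field_simps)
      qed
      finally have "a n / real n < l + e" by simp
      moreover have "l \<le> a n / real n" using n by (intro lower) auto
      ultimately show "norm (a n / real n - l) < e" using e by (simp add: abs_less_iff)
    qed
  qed
  then show ?thesis by (auto simp: convergent_def)
qed

section \<open>Shannon entropy of finite partitions\<close>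

context prob_space
begin

lemma information_space_exp1: "information_space M (exp 1)"
  by unfold_locales simp

lemma partition_entropy_eq_sum:
  assumes "simple_function M X"
  shows "partition_entropy M X =
    (\<Sum>x\<in>X ` space M. - prob (X -` {x} \<inter> space M) * ln (prob (X -` {x} \<inter> space M)))"
proof -
  interpret information_space M "exp 1" by (rule information_space_exp1)
  show ?thesis
    unfolding partition_entropy_def
    by (subst entropy_simple_distributed[OF simple_distributedI[OF assms measure_nonneg refl]])
       (simp add: log_def sum_negf)
qed

lemma partition_entropy_cong:
  assumes "simple_function M X" and eq: "\<And>x. x \<in> space M \<Longrightarrow> X x = Y x"
  shows "partition_entropy M X = partition_entropy M Y"
proof -
  have Y: "simple_function M Y"
    using assms simple_function_cong[of M X Y] by simp
  have "X -` {x} \<inter> space M = Y -` {x} \<inter> space M" for x using eq by auto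
  moreover have "X ` space M = Y ` space M" using eq by auto
  ultimately show ?thesis
    using assms(1) Y by (simp add: partition_entropy_eq_sum)
qed

lemma partition_entropy_nonneg:
  assumes "simple_function M X"
  shows "0 \<le> partition_entropy M X"
  unfolding partition_entropy_eq_sum[OF assms]
proof (rule sum_nonneg)
  fix x
  have "prob (X -` {x} \<inter> space M) * ln (prob (X -` {x} \<inter> space M)) \<le> 0"
    by (cases "prob (X -` {x} \<inter> space M) = 0")
       (auto intro!: mult_nonneg_nonpos simp: zero_less_measure_iff)
  then show "0 \<le> - prob (X -` {x} \<inter> space M) * ln (prob (X -` {x} \<inter> space M))" by simp
qed

lemma partition_entropy_pair_le:
  assumes X: "simple_function M X" and Y: "simple_function M Y"
  shows "partition_entropy M (\<lambda>x. (X x, Y x)) \<le> partition_entropy M X + partition_entropy M Y"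
proof -
  interpret information_space M "exp 1" by (rule information_space_exp1)
  show ?thesis
    unfolding partition_entropy_def entropy_chain_rule[OF X Y]
    using conditional_entropy_less_eq_entropy[OF Y X] by simp
qed

lemma partition_entropy_le_of_factor:
  assumes X: "simple_function M X" and Y: "\<And>x. x \<in> space M \<Longrightarrow> Y x = F (X x)"
  shows "partition_entropy M Y \<le> partition_entropy M X"
proof -
  interpret information_space M "exp 1" by (rule information_space_exp1)
  have "partition_entropy M Y = partition_entropy M (F \<circ> X)"
    using X Y by (intro partition_entropy_cong[symmetric]) auto
  also have "\<dots> \<le> partition_entropy M X"
    unfolding partition_entropy_def using entropy_data_processing[OF X] .
  finally show ?thesis .
qed

lemma partition_entropy_le_ln_card:
  assumes X: "simple_function M X"
  shows "partition_entropy M X \<le> ln (real (card (X ` space M)))"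
proof -
  interpret information_space M "exp 1" by (rule information_space_exp1)
  show ?thesis
    unfolding partition_entropy_def
    using entropy_le_card[OF simple_distributedI[OF X measure_nonneg refl]]
    by (simp add: log_def)
qed

lemma simple_function_map:
  assumes "\<And>i. i \<in> set xs \<Longrightarrow> simple_function M (X i)"
  shows "simple_function M (\<lambda>x. map (\<lambda>i. X i x) xs)"
  using assms
proof (induction xs)
  case (Cons i xs)
  then have "simple_function M (\<lambda>x. (X i x, map (\<lambda>i. X i x) xs))"
    by (intro simple_function_Pair) auto
  from simple_function_compose1[OF this, of "\<lambda>(a, as). a # as"] show ?case by simp
qed simp

lemma partition_entropy_map_le:
  assumes "\<And>i. i \<in> set xs \<Longrightarrow> simple_function M (X i)"
  shows "partition_entropy M (\<lambda>x. map (\<lambda>i. X i x) xs) \<le> (\<Sum>i\<leftarrow>xs. partition_entropy M (X i))"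
  using assms
proof (induction xs)
  case Nil
  have "partition_entropy M (\<lambda>x. map (\<lambda>i. X i x) []) \<le> ln (real (card {[] :: 'b list}))"
    using partition_entropy_le_ln_card[of "\<lambda>x. []"] not_empty by (simp add: image_constant_conv)
  then show ?case by simp
next
  case (Cons i xs)
  have S: "simple_function M (X i)" "simple_function M (\<lambda>x. map (\<lambda>i. X i x) xs)"
    using Cons.prems by (auto intro!: simple_function_map)
  have "partition_entropy M (\<lambda>x. map (\<lambda>i. X i x) (i # xs))
      \<le> partition_entropy M (\<lambda>x. (X i x, map (\<lambda>i. X i x) xs))"
    using S by (intro partition_entropy_le_of_factor[where F = "\<lambda>(a, as). a # as"]
        simple_function_Pair) auto
  also have "\<dots> \<le> partition_entropy M (X i) + partition_entropy M (\<lambda>x. map (\<lambda>i. X i x) xs)"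
    by (intro partition_entropy_pair_le S)
  finally show ?case using Cons by simp
qed

text \<open>The tangent inequality \<open>- t ln t \<le> - t ln s + s - t\<close> makes the bound linear in the
  probability of \<open>E \<noteq> 0\<close>, so that it can be averaged.\<close>

lemma partition_entropy_le_of_mostly_zero:
  fixes E :: "'a \<Rightarrow> nat"
  assumes E: "simple_function M E" and s: "0 < s" "s < 1"
  shows "partition_entropy M E
    \<le> prob {x \<in> space M. E x \<noteq> 0} * (- ln s) + real (card (E ` space M)) * s"
proof -
  let ?q = "\<lambda>x. prob (E -` {x} \<inter> space M)"
  let ?A = "E ` space M"
  have fin: "finite ?A" using E by (rule simple_functionD)
  have tangent: "- t * ln t \<le> t * (- ln r) + (r - t)" if "0 \<le> t" "0 < r" for t r :: real
  proof (cases "t = 0")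
    case False
    then have "ln (r / t) \<le> r / t - 1" using that by (intro ln_le_minus_one) auto
    then have "t * ln (r / t) \<le> t * (r / t - 1)" using that by (intro mult_left_mono)
    then show ?thesis using False that by (simp add: ln_div algebra_simps)
  qed (use that in simp)
  have sets_E: "E -` {x} \<inter> space M \<in> events" for x using E by (rule simple_functionD)
  have total: "(\<Sum>x\<in>?A - {0}. ?q x) = prob {x \<in> space M. E x \<noteq> 0}"
  proof -
    have "(\<Sum>x\<in>?A - {0}. ?q x) = prob (\<Union>x\<in>?A - {0}. E -` {x} \<inter> space M)"
      using fin sets_E by (intro finite_measure_finite_Union[symmetric])
        (auto simp: disjoint_family_on_def)
    also have "(\<Union>x\<in>?A - {0}. E -` {x} \<inter> space M) = {x \<in> space M. E x \<noteq> 0}" by auto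
    finally show ?thesis .
  qed
  have "?q 0 = 1 - prob {x \<in> space M. E x \<noteq> 0}"
  proof -
    have "space M - (E -` {0} \<inter> space M) = {x \<in> space M. E x \<noteq> 0}" by auto
    then show ?thesis using prob_compl[OF sets_E[of 0]] by simp
  qed
  then have zero: "- ?q 0 * ln (?q 0) \<le> prob {x \<in> space M. E x \<noteq> 0}"
    using tangent[of "?q 0" 1] by simp
  \<comment> \<open>The value 0 may lie outside the range of \<open>E\<close>; its term is
    nonnegative and can then be added for free.\<close>
  have zero0: "0 \<le> - ?q 0 * ln (?q 0)"
  proof -
    have "?q 0 * ln (?q 0) \<le> 0"
      by (cases "?q 0 = 0") (auto intro!: mult_nonneg_nonpos simp: zero_less_measure_iff)
    then show ?thesis by simp
  qed
  have "partition_entropy M E = (\<Sum>x\<in>?A. - ?q x * ln (?q x))"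
    by (rule partition_entropy_eq_sum[OF E])
  also have "\<dots> \<le> - ?q 0 * ln (?q 0) + (\<Sum>x\<in>?A - {0}. - ?q x * ln (?q x))"
    using fin zero0 by (cases "0 \<in> ?A") (simp_all add: sum.remove)
  also have "\<dots> \<le> prob {x \<in> space M. E x \<noteq> 0} + (\<Sum>x\<in>?A - {0}. ?q x * (- ln s) + (s - ?q x))"
    using s by (intro add_mono zero sum_mono tangent) auto
  \<comment> \<open>The summands \<open>- ?q x\<close> add up to minus the probability of a nonzero
    value. They cancel the contribution of the value 0, which was estimated with the reference value
    1 instead of \<open>s\<close>.\<close>
  also have "\<dots> = prob {x \<in> space M. E x \<noteq> 0} * (- ln s) + real (card (?A - {0})) * s"
    by (simp only: sum.distrib sum_subtractf sum_distrib_right[symmetric] total) simp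
  also have "\<dots> \<le> prob {x \<in> space M. E x \<noteq> 0} * (- ln s) + real (card ?A) * s"
    using s fin by (intro add_left_mono mult_right_mono) (auto intro!: card_mono)
  finally show ?thesis .
qed

lemma partition_entropy_measure_preserving:
  assumes X: "simple_function M X" and T: "measure_preserving_map M T"
  shows "simple_function M (\<lambda>x. X (T x))"
    and "partition_entropy M (\<lambda>x. X (T x)) = partition_entropy M X"
proof -
  have meas: "T \<in> M \<rightarrow>\<^sub>M M" and distr: "distr M M T = M"
    using T by (auto simp: measure_preserving_map_def)
  show XT: "simple_function M (\<lambda>x. X (T x))"
    by (rule simple_function_comp[OF meas X, unfolded comp_def])
  let ?q = "\<lambda>x. prob (X -` {x} \<inter> space M)"
  have q: "prob ((\<lambda>x. X (T x)) -` {x} \<inter> space M) = ?q x" for x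
  proof -
    have "?q x = measure (distr M M T) (X -` {x} \<inter> space M)" by (simp add: distr)
    also have "\<dots> = prob (T -` (X -` {x} \<inter> space M) \<inter> space M)"
      using X meas by (intro measure_distr) (auto dest: simple_functionD)
    also have "T -` (X -` {x} \<inter> space M) \<inter> space M = (\<lambda>x. X (T x)) -` {x} \<inter> space M"
      using measurable_space[OF meas] by auto
    finally show ?thesis by simp
  qed
  have "partition_entropy M (\<lambda>x. X (T x)) = (\<Sum>x\<in>(\<lambda>x. X (T x)) ` space M. - ?q x * ln (?q x))"
    by (simp add: partition_entropy_eq_sum[OF XT] q)
  \<comment> \<open>The composition with \<open>T\<close> may miss some values of \<open>X\<close>.
    By invariance such values have probability 0 and contribute nothing.\<close>
  also have "\<dots> = (\<Sum>x\<in>X ` space M. - ?q x * ln (?q x))"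
  proof (rule sum.mono_neutral_left)
    show "finite (X ` space M)" using X by (rule simple_functionD)
    show "(\<lambda>x. X (T x)) ` space M \<subseteq> X ` space M" using measurable_space[OF meas] by auto
    show "\<forall>x\<in>X ` space M - (\<lambda>x. X (T x)) ` space M. - ?q x * ln (?q x) = 0"
    proof
      fix x assume "x \<in> X ` space M - (\<lambda>x. X (T x)) ` space M"
      then have "(\<lambda>x. X (T x)) -` {x} \<inter> space M = {}" by (auto simp: image_iff)
      with q[of x] show "- ?q x * ln (?q x) = 0" by simp
    qed
  qed
  finally show "partition_entropy M (\<lambda>x. X (T x)) = partition_entropy M X"
    by (simp add: partition_entropy_eq_sum[OF X])
qed

section \<open>Itineraries and the existence of the entropy rate\<close>

lemma measure_preserving_map_funpow:
  assumes "measure_preserving_map M T"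
  shows "measure_preserving_map M (T ^^ n)"
proof (induction n)
  case (Suc n)
  have T: "T \<in> M \<rightarrow>\<^sub>M M" "distr M M T = M" and Tn: "T ^^ n \<in> M \<rightarrow>\<^sub>M M" "distr M M (T ^^ n) = M"
    using assms Suc by (auto simp: measure_preserving_map_def)
  have "distr M M (T \<circ> T ^^ n) = M"
    using distr_distr[OF T(1) Tn(1)] T(2) Tn(2) by simp
  moreover have "T \<circ> T ^^ n \<in> M \<rightarrow>\<^sub>M M" using T(1) Tn(1) by (rule measurable_comp[rotated])
  ultimately show ?case by (simp add: measure_preserving_map_def comp_def)
qed (simp add: measure_preserving_map_def id_def distr_id)

lemma simple_function_itinerary:
  assumes P: "simple_function M P" and T: "measure_preserving_map M T"
  shows "simple_function M (itinerary T P n)"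
  unfolding itinerary_def
  by (intro simple_function_map
      partition_entropy_measure_preserving(1)[OF P measure_preserving_map_funpow[OF T]])

text \<open>The operator \<open>lim\<close> in \<open>entropy_rate\<close> carries information only
  once convergence is known. An itinerary of length \<open>k + n\<close> is one of length
  \<open>k\<close> followed by one of length \<open>n\<close> started at the \<open>k\<close>-th
  image, so invariance of the measure makes the entropies subadditive.\<close>

lemma entropy_rate_limit:
  assumes P: "simple_function M P" and T: "measure_preserving_map M T"
  shows "(\<lambda>n. partition_entropy M (itinerary T P n) / real n) \<longlonglongrightarrow> entropy_rate M T P"
proof -
  have "convergent (\<lambda>n. partition_entropy M (itinerary T P n) / real n)"
  proof (rule subadditive_quotient_convergent)
    fix k n
    have split: "itinerary T P (k + n) x = itinerary T P k x @ itinerary T P n ((T ^^ k) x)" for x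
    proof -
      have "map (\<lambda>i. P ((T ^^ i) x)) [k..<k + n] = map (\<lambda>i. P ((T ^^ (i + k)) x)) [0..<n]"
        by (rule nth_equalityI) (auto simp: add.commute)
      then show ?thesis
        unfolding itinerary_def by (simp add: upt_add_eq_append[of 0 k n] funpow_add)
    qed
    note S = simple_function_itinerary[OF P T]
    note inv = partition_entropy_measure_preserving[OF S measure_preserving_map_funpow[OF T]]
    have "partition_entropy M (itinerary T P (k + n))
        \<le> partition_entropy M (\<lambda>x. (itinerary T P k x, itinerary T P n ((T ^^ k) x)))"
      using S inv(1) by (intro partition_entropy_le_of_factor[where F = "\<lambda>(u, v). u @ v"]
          simple_function_Pair) (auto simp: split)
    also have "\<dots> \<le> partition_entropy M (itinerary T P k)
        + partition_entropy M (\<lambda>x. itinerary T P n ((T ^^ k) x))"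
      by (intro partition_entropy_pair_le S inv(1))
    finally show "partition_entropy M (itinerary T P (k + n))
        \<le> partition_entropy M (itinerary T P k) + partition_entropy M (itinerary T P n)"
      by (simp add: inv(2))
  qed (intro partition_entropy_nonneg simple_function_itinerary P T)
  then show ?thesis
    by (simp add: entropy_rate_def convergent_LIMSEQ_iff)
qed

end

section \<open>Automorphisms of the rooted tree\<close>

definition level :: "nat \<Rightarrow> nat \<Rightarrow> nat list set" where
  "level p n = {v \<in> words p. length v = n}"

text \<open>Automorphisms of the infinite tree, so that one map serves all depths at once.
  Injectivity is enough, since every level is finite.\<close>

definition tree_iso :: "nat \<Rightarrow> (nat list \<Rightarrow> nat list) \<Rightarrow> bool" where
  "tree_iso p A \<longleftrightarrow>
     (\<forall>v\<in>words p. A v \<in> words p \<and> length (A v) = length v) \<and>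
     (\<forall>v i. v @ [i] \<in> words p \<longrightarrow> (\<exists>j. A (v @ [i]) = A v @ [j])) \<and>
     inj_on A (words p)"

lemma words_simps [simp]:
  "[] \<in> words p" "a # v \<in> words p \<longleftrightarrow> a < p \<and> v \<in> words p"
  "u @ v \<in> words p \<longleftrightarrow> u \<in> words p \<and> v \<in> words p"
  by (auto simp: words_def)

lemma words_take: "v \<in> words p \<Longrightarrow> take n v \<in> words p"
  and words_drop: "v \<in> words p \<Longrightarrow> drop n v \<in> words p"
  by (auto simp: words_def dest: in_set_takeD in_set_dropD)

lemma level_eq: "level p n = {v. set v \<subseteq> {..<p} \<and> length v = n}"
  by (auto simp: level_def words_def)

lemma finite_level [simp]: "finite (level p n)"
  unfolding level_eq by (rule finite_lists_length_eq) simp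

lemma card_level: "card (level p n) = p ^ n"
  unfolding level_eq by (subst card_lists_length_eq) auto

lemma words_upto_eq_UN: "words_upto p n = (\<Union>l\<le>n. level p l)"
  by (auto simp: words_upto_def level_def)

lemma finite_words_upto [simp]: "finite (words_upto p n)"
  by (simp add: words_upto_eq_UN)

lemma finite_tree_automorphisms: "finite (tree_automorphisms p n)"
proof (rule finite_subset)
  show "tree_automorphisms p n \<subseteq> words_upto p n \<rightarrow>\<^sub>E words_upto p n"
    by (auto simp: tree_automorphisms_def PiE_def dest: bij_betwE)
qed (auto intro: finite_PiE)

lemma tree_isoD:
  assumes "tree_iso p A"
  shows "v \<in> words p \<Longrightarrow> A v \<in> words p" "v \<in> words p \<Longrightarrow> length (A v) = length v"
    "v @ [i] \<in> words p \<Longrightarrow> \<exists>j. A (v @ [i]) = A v @ [j]" "inj_on A (words p)" "A [] = []"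
proof -
  show "A [] = []" using assms unfolding tree_iso_def
    by (metis length_0_conv words_simps(1))
qed (use assms in \<open>auto simp: tree_iso_def\<close>)

lemma tree_iso_id: "tree_iso p (\<lambda>v. v)"
  by (auto simp: tree_iso_def)

text \<open>An injective self-map of a finite set is bijective. For the backward direction on edges,
  the parent of \<open>A v\<close> is the image of the parent of \<open>v\<close>, and injectivity
  identifies that parent with \<open>u\<close>.\<close>

lemma tree_iso_restrict:
  assumes A: "tree_iso p A"
  shows "restrict A (words_upto p n) \<in> tree_automorphisms p n"
proof -
  note D = tree_isoD[OF A]
  have inj: "inj_on A (words_upto p n)"
    using D(4) by (rule inj_on_subset) (auto simp: words_upto_def)
  moreover have "A ` words_upto p n \<subseteq> words_upto p n"
    using D by (auto simp: words_upto_def)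
  ultimately have "bij_betw A (words_upto p n) (words_upto p n)"
    by (simp add: bij_betw_def endo_inj_surj)
  then have bij: "bij_betw (restrict A (words_upto p n)) (words_upto p n) (words_upto p n)"
    by (simp cong: bij_betw_cong)
  have edge: "tree_edge u v \<longleftrightarrow> tree_edge (A u) (A v)" if u: "u \<in> words p" and v: "v \<in> words p" for u v
  proof
    assume "tree_edge u v"
    then show "tree_edge (A u) (A v)" using D(3)[of u] v by (auto simp: tree_edge_def)
  next
    assume "tree_edge (A u) (A v)"
    then obtain j where j: "A v = A u @ [j]" by (auto simp: tree_edge_def)
    then have "length v = Suc (length u)" using D(2) u v by (metis length_append_singleton)
    then obtain w i where w: "v = w @ [i]" by (metis length_Suc_conv_rev)
    with v D(3)[of w i] obtain j' where "A v = A w @ [j']" by auto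
    with j have "A w = A u" by simp
    with D(4) u v w have "w = u" by (auto dest: inj_onD)
    with w show "tree_edge u v" by (auto simp: tree_edge_def)
  qed
  show ?thesis
    using bij D edge by (auto simp: tree_automorphisms_def words_upto_def)
qed

text \<open>Any single automorphism bounds the minimum. Grouping the nodes by length turns the
  weighted sum into a sum of averages over the levels, the form in which bad nodes are
  counted.\<close>

lemma tbar_le:
  assumes A: "tree_iso p A"
  shows "tbar p n h h' \<le> 1 / real n *
    (\<Sum>l=1..n. (1 / real p) ^ l * (\<Sum>v\<in>level p l. dist (h v) (h' (A v))))"
proof -
  let ?W = "{v. v \<in> words_upto p n \<and> 0 < length v}"
  let ?cost = "\<lambda>A. \<Sum>v\<in>?W. (1 / real p) ^ length v * dist (h v) (h' (A v))"
  have "tbar p n h h' \<le> 1 / real n * ?cost (restrict A (words_upto p n))"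
    unfolding tbar_def
    by (intro Min_le finite_imageI imageI tree_iso_restrict[OF A] finite_tree_automorphisms)
  also have "?cost (restrict A (words_upto p n)) = ?cost A"
    by (intro sum.cong) auto
  also have "?W = (\<Union>l\<in>{1..n}. level p l)"
    by (auto simp: words_upto_def level_def Suc_le_eq)
  also have "(\<Sum>v\<in>(\<Union>l\<in>{1..n}. level p l). (1 / real p) ^ length v * dist (h v) (h' (A v)))
      = (\<Sum>l=1..n. \<Sum>v\<in>level p l. (1 / real p) ^ length v * dist (h v) (h' (A v)))"
    by (intro sum.UNION_disjoint) (auto simp: level_def finite_level[unfolded level_def])
  also have "\<dots> = (\<Sum>l=1..n. (1 / real p) ^ l * (\<Sum>v\<in>level p l. dist (h v) (h' (A v))))"
    by (intro sum.cong refl) (auto simp: sum_distrib_left level_def)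
  finally show ?thesis .
qed

text \<open>Each level contributes an average: at most 1 below level \<open>l0\<close>, and at most
  \<open>q + e\<close> from there on, where bad nodes cost at most 1 each and the others at most
  \<open>e\<close>.\<close>

lemma tbar_le_of_few_bad:
  fixes e q :: real
  assumes p: "0 < p" and n: "0 < n" and A: "tree_iso p A" and e: "0 \<le> e" and q: "0 \<le> q"
    and le1: "\<And>v. v \<in> words p \<Longrightarrow> dist (h v) (h' (A v)) \<le> 1"
    and bad: "\<And>l. l \<ge> l0 \<Longrightarrow> card {v \<in> level p l. e < dist (h v) (h' (A v))} \<le> q * p ^ l"
  shows "tbar p n h h' \<le> real l0 / real n + q + e"
proof -
  let ?s = "\<lambda>l. (1 / real p) ^ l * (\<Sum>v\<in>level p l. dist (h v) (h' (A v)))"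
  have pl: "(1 / real p) ^ l * real (p ^ l) = 1" for l
    using p by (simp add: power_one_over)
  have "?s l \<le> (if l < l0 then 1 else 0) + (q + e)" for l
  proof (cases "l < l0")
    case True
    have "?s l \<le> (1 / real p) ^ l * (\<Sum>v\<in>level p l. 1)"
      by (intro mult_left_mono sum_mono le1) (auto simp: level_def)
    also have "\<dots> = 1" using pl[of l] by (simp add: card_level)
    finally show ?thesis using True e q by simp
  next
    case False
    let ?bad = "{v \<in> level p l. e < dist (h v) (h' (A v))}"
    have "(\<Sum>v\<in>level p l. dist (h v) (h' (A v)))
        \<le> (\<Sum>v\<in>level p l. (if v \<in> ?bad then 1 else 0) + e)"
      using le1 e by (intro sum_mono) (auto simp: add_increasing2 level_def)
    also have "\<dots> = (\<Sum>v\<in>level p l. if v \<in> ?bad then 1 else 0) + e * p ^ l"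
      by (simp add: sum.distrib card_level)
    also have "(\<Sum>v\<in>level p l. if v \<in> ?bad then 1 else 0) = real (card ?bad)"
      by (subst sum.If_cases) (auto intro!: arg_cong[where f = card])
    also have "\<dots> + e * p ^ l \<le> (q + e) * p ^ l"
      using bad[of l] False by (simp add: algebra_simps)
    finally have "?s l \<le> (1 / real p) ^ l * ((q + e) * p ^ l)"
      by (intro mult_left_mono) auto
    also have "\<dots> = q + e" using pl[of l] by (simp add: algebra_simps)
    finally show ?thesis using False by simp
  qed
  then have "(\<Sum>l=1..n. ?s l) \<le> (\<Sum>l=1..n. (if l < l0 then 1 else 0) + (q + e))"
    by (intro sum_mono)
  also have "\<dots> = real (card {l \<in> {1..n}. l < l0}) + n * (q + e)"
    by (simp add: sum.distrib sum.If_cases Int_def)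
  also have "card {l \<in> {1..n}. l < l0} \<le> card {..<l0}"
    by (intro card_mono) auto
  finally have "(\<Sum>l=1..n. ?s l) \<le> real l0 + n * (q + e)" by simp
  then have "1 / real n * (\<Sum>l=1..n. ?s l) \<le> 1 / real n * (real l0 + n * (q + e))"
    by (intro mult_left_mono) auto
  also have "\<dots> = real l0 / real n + q + e"
    using n by (simp add: field_simps)
  finally show ?thesis using tbar_le[OF A, of n h h'] by linarith
qed

text \<open>The recursive structure of the automorphism group: \<open>B\<close> acts on the first
  \<open>n\<close> levels, and the subtree below each node \<open>u\<close> of level
  \<open>n\<close> is moved by its own \<open>A u\<close>. On shorter words the second factor is
  applied to \<open>[]\<close> and disappears.\<close>

lemma tree_iso_glue:
  assumes B: "tree_iso p B" and A: "\<And>u. u \<in> words p \<Longrightarrow> tree_iso p (A u)"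
  shows "tree_iso p (\<lambda>u. B (take n u) @ A (take n u) (drop n u))"
  unfolding tree_iso_def
proof (intro conjI ballI allI impI inj_onI)
  note DB = tree_isoD[OF B] and DA = tree_isoD[OF A]
  fix v assume v: "v \<in> words p"
  show "B (take n v) @ A (take n v) (drop n v) \<in> words p"
    "length (B (take n v) @ A (take n v) (drop n v)) = length v"
    using v DB DA by (simp_all add: words_take words_drop)
next
  note DB = tree_isoD[OF B] and DA = tree_isoD[OF A]
  fix v i assume v: "v @ [i] \<in> words p"
  show "\<exists>j. B (take n (v @ [i])) @ A (take n (v @ [i])) (drop n (v @ [i]))
      = (B (take n v) @ A (take n v) (drop n v)) @ [j]"
  proof (cases "length v < n")
    case True
    then have "drop n (v @ [i]) = []" "take n (v @ [i]) = v @ [i]" "drop n v = []" "take n v = v"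
      by simp_all
    with v DB(3)[of v i] DA(5) show ?thesis by (auto simp del: take_append drop_append)
  next
    case False
    then have eq: "drop n (v @ [i]) = drop n v @ [i]" "take n (v @ [i]) = take n v" by simp_all
    show ?thesis unfolding eq
      using v DA(3)[of "take n v" "drop n v" i] by (auto simp: words_take words_drop)
  qed
next
  note DB = tree_isoD[OF B] and DA = tree_isoD[OF A]
  fix u v assume u: "u \<in> words p" and v: "v \<in> words p"
    and eq: "B (take n u) @ A (take n u) (drop n u) = B (take n v) @ A (take n v) (drop n v)"
  have "length u = length v"
    using arg_cong[OF eq, of length] u v DB DA by (simp add: words_take words_drop)
  then have "length (B (take n u)) = length (B (take n v))"
    using DB(2) u v by (simp add: words_take)
  with eq have eq': "B (take n u) = B (take n v)"
    "A (take n u) (drop n u) = A (take n v) (drop n v)" by simp_all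
  from inj_onD[OF DB(4) eq'(1)] u v have t: "take n u = take n v" by (simp add: words_take)
  with eq'(2) inj_onD[OF DA(4)[of "take n v"]] u v have "drop n u = drop n v"
    by (metis words_take words_drop)
  with t show "u = v" by (metis append_take_drop_id)
qed

text \<open>Transitivity on levels, by recursion on the first letter: swap the two first letters and
  act below every child by the automorphism obtained for the remaining words.\<close>

lemma ex_tree_iso_mapping_word:
  assumes "v \<in> words p" "w \<in> words p" "length v = length w"
  shows "\<exists>A. tree_iso p A \<and> A v = w"
  using assms
proof (induction v arbitrary: w)
  case Nil
  then show ?case using tree_iso_id by auto
next
  case (Cons a v)
  then obtain b w' where w: "w = b # w'" by (metis length_Suc_conv)
  with Cons obtain A where A: "tree_iso p A" "A v = w'" by force
  \<comment> \<open>The transposition of \<open>a\<close> and \<open>b\<close>. Applied to all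
    letters it is a tree automorphism; the gluing uses it on the first letter only.\<close>
  let ?t = "\<lambda>c. if c = a then b else if c = b then a else c"
  let ?B = "map ?t"
  have ab: "a < p" "b < p" using Cons w by auto
  have inj: "inj ?t" by (auto simp: inj_def split: if_splits)
  have B: "tree_iso p ?B"
    using ab inj by (auto simp: tree_iso_def words_def intro!: inj_on_subset[OF inj_mapI])
  let ?G = "\<lambda>u. ?B (take 1 u) @ A (drop 1 u)"
  have "tree_iso p ?G" by (rule tree_iso_glue[OF B A(1)])
  moreover have "?G (a # v) = w" using A w by simp
  ultimately show ?case by blast
qed

lemma branch_simps [simp]:
  "branch S [] x = x" "branch S (a # v) x = branch S v (S a x)"
  "branch S (u @ v) x = branch S v (branch S u x)"
  by (simp_all add: branch_def)

lemma branch_closed: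
  assumes "\<And>i x. i < p \<Longrightarrow> x \<in> \<Omega> \<Longrightarrow> S i x \<in> \<Omega>" "v \<in> words p" "x \<in> \<Omega>"
  shows "branch S v x \<in> \<Omega>"
  using assms(2,3) by (induction v arbitrary: x) (auto intro: assms(1))

text \<open>One node in \<open>p\<^sup>r\<close> can be matched so that both branches enter \<open>D\<close>; below such a node the
  identity keeps the pair \<open>R\<close>-close, and below the others the matching is repeated.\<close>

lemma ex_tree_iso_few_bad:
  assumes p: "0 < p"
    and closed: "\<And>i x. i < p \<Longrightarrow> x \<in> \<Omega> \<Longrightarrow> S i x \<in> \<Omega>"
    and hit: "\<And>x. x \<in> \<Omega> \<Longrightarrow> \<exists>v\<in>level p r. branch S v x \<in> D"
    and R: "\<And>x y u. x \<in> D \<Longrightarrow> y \<in> D \<Longrightarrow> u \<in> words p \<Longrightarrow> R (branch S u x) (branch S u y)"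
    and "x \<in> \<Omega>" "y \<in> \<Omega>"
  shows "\<exists>A. tree_iso p A \<and> (\<forall>l\<ge>k * r.
    card {u \<in> level p l. \<not> R (branch S u x) (branch S (A u) y)} \<le> (1 - 1 / p ^ r) ^ k * p ^ l)"
  using assms(5,6)
proof (induction k arbitrary: x y)
  case 0
  have "card {u \<in> level p l. \<not> R (branch S u x) (branch S u y)} \<le> real p ^ l" for l
    using card_mono[of "level p l" "{u \<in> level p l. \<not> R (branch S u x) (branch S u y)}"]
    by (simp add: card_level flip: of_nat_power)
  then show ?case using tree_iso_id by (intro exI[of _ "\<lambda>v. v"]) auto
next
  case (Suc k)
  define bad where "bad A l x y = {u \<in> level p l. \<not> R (branch S u x) (branch S (A u) y)}" for A l x y
  define good where "good A x y \<longleftrightarrow> tree_iso p A \<and>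
      (\<forall>l\<ge>k * r. card (bad A l x y) \<le> (1 - 1 / p ^ r) ^ k * p ^ l)" for A x y
  have IH: "\<exists>A. good A x y" if "x \<in> \<Omega>" "y \<in> \<Omega>" for x y
    using Suc.IH[OF that] unfolding good_def bad_def by simp
  obtain v w where v: "v \<in> level p r" "branch S v x \<in> D" and w: "w \<in> level p r" "branch S w y \<in> D"
    using hit Suc.prems by blast
  then have vw: "v \<in> words p" "w \<in> words p" "length v = r" "length w = r" by (auto simp: level_def)
  then obtain B where B: "tree_iso p B" "B v = w" using ex_tree_iso_mapping_word by metis
  note DB = tree_isoD[OF B(1)]
  \<comment> \<open>Below \<open>v\<close> both points are already in \<open>D\<close>, so the
    identity has no bad node there. Below every other node the induction hypothesis is applied to
    the actual pair of endpoints, which is why it has to hold for all pairs.\<close>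
  define A where "A u = (if u = v then (\<lambda>u. u)
      else (SOME A. good A (branch S u x) (branch S (B u) y)))" for u
  have good_A: "good (A u) (branch S u x) (branch S (B u) y)" if "u \<in> words p" "u \<noteq> v" for u
  proof -
    have "branch S u x \<in> \<Omega>" "branch S (B u) y \<in> \<Omega>"
      using branch_closed[OF closed] that DB Suc.prems by auto
    then show ?thesis using someI_ex[OF IH] that by (simp add: A_def)
  qed
  have iso_A: "tree_iso p (A u)" if "u \<in> words p" for u
    using good_A[OF that] by (cases "u = v") (auto simp: A_def tree_iso_id good_def)
  let ?G = "\<lambda>u. B (take r u) @ A (take r u) (drop r u)"
  have "card (bad ?G l x y) \<le> (1 - 1 / p ^ r) ^ Suc k * p ^ l" if l: "l \<ge> Suc k * r" for l
  proof -
    define l' where "l' = l - r"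
    have l': "l = r + l'" "l' \<ge> k * r" using l by (auto simp: l'_def)
    let ?b = "\<lambda>u. bad (A u) l' (branch S u x) (branch S (B u) y)"
    have empty: "?b v = {}"
      using R v w B by (auto simp: bad_def A_def level_def)
    have "bad ?G l x y \<subseteq> (\<Union>u\<in>level p r. (@) u ` ?b u)"
    proof
      fix u assume u: "u \<in> bad ?G l x y"
      let ?s = "take r u" and ?t = "drop r u"
      have uw: "u \<in> words p" "length u = l" using u by (auto simp: bad_def level_def)
      then have st: "?s \<in> level p r" "?t \<in> level p l'"
        using l' by (auto simp: level_def words_take words_drop)
      have "\<not> R (branch S (?s @ ?t) x) (branch S (B ?s @ A ?s ?t) y)"
        using u unfolding append_take_drop_id by (simp add: bad_def)
      then have "\<not> R (branch S ?t (branch S ?s x)) (branch S (A ?s ?t) (branch S (B ?s) y))"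
        unfolding branch_simps(3) .
      then have "?t \<in> ?b ?s" using st by (simp add: bad_def)
      then have "?s @ ?t \<in> (@) ?s ` ?b ?s" by blast
      with st(1) show "u \<in> (\<Union>u\<in>level p r. (@) u ` ?b u)"
        unfolding append_take_drop_id by blast
    qed
    moreover have fin: "finite (?b u)" for u unfolding bad_def by simp
    ultimately have "card (bad ?G l x y) \<le> card (\<Union>u\<in>level p r. (@) u ` ?b u)"
      by (intro card_mono) auto
    also have "\<dots> \<le> (\<Sum>u\<in>level p r. card ((@) u ` ?b u))"
      by (intro card_UN_le) simp
    also have "\<dots> \<le> (\<Sum>u\<in>level p r. card (?b u))"
      by (intro sum_mono card_image_le fin)
    also have "\<dots> = (\<Sum>u\<in>level p r - {v}. card (?b u))"
      using v empty by (subst sum.remove[of _ v]) auto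
    finally have "real (card (bad ?G l x y)) \<le> real (\<Sum>u\<in>level p r - {v}. card (?b u))"
      by (rule of_nat_mono)
    also have "\<dots> = (\<Sum>u\<in>level p r - {v}. real (card (?b u)))" by (rule of_nat_sum)
    also have "\<dots> \<le> (\<Sum>u\<in>level p r - {v}. (1 - 1 / p ^ r) ^ k * p ^ l')"
      using good_A l' by (intro sum_mono) (auto simp: good_def level_def)
    \<comment> \<open>Of the \<open>p ^ r\<close> subtrees at level \<open>r\<close> all but the one
      at \<open>v\<close> contribute; this is the factor \<open>1 - 1 / p ^ r\<close>.\<close>
    also have "\<dots> = (real p ^ r - 1) * ((1 - 1 / p ^ r) ^ k * p ^ l')"
      using v p by (simp add: card_Diff_singleton card_level of_nat_diff)
    also have "\<dots> = (1 - 1 / p ^ r) ^ Suc k * p ^ l"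
      using p l' by (simp add: power_add field_simps)
    finally show ?thesis .
  qed
  then show ?case
    using tree_iso_glue[OF B(1) iso_A, where n = r] unfolding bad_def by (intro exI[of _ ?G]) auto
qed

section \<open>Inverse branches of the extension\<close>

text \<open>Each letter is put in front, so the last letter of \<open>v\<close> ends at coordinate
  0. This is the source of the reversed words below.\<close>

lemma branch_std_inverse:
  "branch std_inverse v b = (\<lambda>i. if i < length v then rev v ! i else b (i - length v))"
proof (induction v arbitrary: b)
  case (Cons a v)
  have "std_inverse a b (i - length v) = (if i < Suc (length v) then a else b (i - Suc (length v)))"
    if "\<not> i < length v" for i
    using that by (auto simp: std_inverse_def split: nat.splits intro!: arg_cong[where f = b])
  then show ?case
    unfolding branch_simps Cons.IH by (auto simp: nth_append fun_eq_iff std_inverse_def)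
qed simp

locale summable_extension =
  fixes p :: nat and m :: "'z::metric_space measure" and f :: "(nat \<Rightarrow> nat) \<Rightarrow> 'z \<Rightarrow> 'z"
  assumes p_ge_2: "p \<ge> 2"
    and compact_UNIV: "compact (UNIV :: 'z set)"
    and transitive: "\<forall>z w :: 'z. \<exists>\<phi>\<in>isometries. \<phi> z = w"
    and prob_m: "prob_space m"
    and sets_m: "sets m = sets borel"
    and invariant: "\<forall>\<phi>\<in>isometries. distr m m \<phi> = m"
    and f_isometry: "f \<in> space (std_space p) \<rightarrow> isometries"
    and summable: "summable_cocycle p f"
begin

definition "M = std_space p \<Otimes>\<^sub>M m"
definition "T = cocycle_extension f"
text \<open>A preimage of \<open>x\<close> with first symbol \<open>i\<close> has base point
  \<open>std_inverse i (fst x)\<close>; its fibre coordinate is found by undoing the isometry that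
  \<open>f\<close> assigns to this base point, not to \<open>fst x\<close>.\<close>

definition S :: "nat \<Rightarrow> (nat \<Rightarrow> nat) \<times> 'z \<Rightarrow> (nat \<Rightarrow> nat) \<times> 'z" where
  "S i x = (std_inverse i (fst x), inv (f (std_inverse i (fst x))) (snd x))"
definition "K i = {x \<in> space M. fst x 0 = i}"
text \<open>The basic entourages of the product uniformity on sequences and fibre.\<close>

definition close :: "nat \<Rightarrow> real \<Rightarrow> (nat \<Rightarrow> nat) \<times> 'z \<Rightarrow> (nat \<Rightarrow> nat) \<times> 'z \<Rightarrow> bool" where
  "close k d x y \<longleftrightarrow> (\<forall>i<k. fst x i = fst y i) \<and> dist (snd x) (snd y) < d"
text \<open>The sum starts with index \<open>k\<close>. Points that agree in \<open>k\<close>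
  symbols will pay \<open>tail (Suc k)\<close>: a prefixed symbol makes the base points agree in
  \<open>k + 1\<close> symbols before \<open>f\<close> is evaluated there.\<close>

definition "tail k = (\<Sum>j. cocycle_variation p f (j + k))"

lemma space_std: "b \<in> space (std_space p) \<longleftrightarrow> (\<forall>i. b i < p)"
  by (auto simp: std_space_def space_PiM space_uniform_count_measure PiE_def)

lemma p_pos: "0 < p" using p_ge_2 by simp

lemma space_m [simp]: "space m = UNIV"
  using sets_eq_imp_space_eq[OF sets_m] by simp

lemma space_M: "x \<in> space M \<longleftrightarrow> (\<forall>i. fst x i < p)"
  by (cases x) (auto simp: M_def space_pair_measure space_std)

lemma fst_space: "x \<in> space M \<Longrightarrow> fst x \<in> space (std_space p)"
  by (simp add: space_M space_std)

lemma isometryD: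
  assumes "\<phi> \<in> isometries"
  shows "bij \<phi>" "dist (\<phi> z) (\<phi> w) = dist z w"
  using assms by (auto simp: isometries_def)

lemma f_isometries: "b \<in> space (std_space p) \<Longrightarrow> f b \<in> isometries"
  using f_isometry by auto

lemma isometry_inverse:
  assumes "\<phi> \<in> isometries"
  shows "inv \<phi> (\<phi> z) = z" "\<phi> (inv \<phi> z) = z" "inv \<phi> \<in> isometries"
proof -
  have bij: "bij \<phi>" using assms by (rule isometryD)
  show 1: "inv \<phi> (\<phi> z) = z" for z using bij by (simp add: bij_is_inj)
  show 2: "\<phi> (inv \<phi> z) = z" for z using bij by (simp add: bij_is_surj surj_f_inv_f)
  have "dist (inv \<phi> z) (inv \<phi> w) = dist z w" for z w
    using isometryD(2)[OF assms, of "inv \<phi> z" "inv \<phi> w"] by (simp add: 2)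
  then show "inv \<phi> \<in> isometries" using bij by (simp add: isometries_def bij_imp_bij_inv)
qed

lemma continuous_isometry: "\<phi> \<in> isometries \<Longrightarrow> continuous_on A \<phi>"
  by (auto simp: continuous_on_iff isometryD)

lemma isometry_measurable: "\<phi> \<in> isometries \<Longrightarrow> \<phi> \<in> m \<rightarrow>\<^sub>M m"
  using borel_measurable_continuous_onI[OF continuous_isometry, of \<phi>]
  by (simp add: measurable_cong_sets[OF sets_m sets_m])

section \<open>Variation of the cocycle and of its inverses\<close>

lemma ex_dist_bound: "\<exists>D>0. \<forall>z w :: 'z. dist z w \<le> D"
proof -
  have bdd: "bounded (UNIV :: 'z set)" using compact_UNIV by (rule compact_imp_bounded)
  have "dist z w \<le> max 1 (diameter (UNIV :: 'z set))" for z w :: 'z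
    using diameter_bounded_bound[OF bdd, of z w] by simp
  then show ?thesis by (intro exI[of _ "max 1 (diameter (UNIV :: 'z set))"]) simp
qed

text \<open>The variation is an iterated supremum of reals and bounds its members only if the sets
  involved are bounded above. Compactness of the fibre bounds all distances, and there are finitely
  many words of length \<open>k\<close>. The common cylinder of \<open>b\<close> and
  \<open>b'\<close> is the range of the branch along their reversed prefix.\<close>

lemma dist_cocycle_le:
  assumes b: "b \<in> space (std_space p)" "b' \<in> space (std_space p)" and agree: "\<And>i. i < k \<Longrightarrow> b i = b' i"
  shows "dist (f b z) (f b' z) \<le> cocycle_variation p f k"
proof -
  obtain D where D: "\<And>z w :: 'z. dist z w \<le> D" using ex_dist_bound by auto
  let ?v = "rev (map b [0..<k])"
  let ?C = "branch std_inverse ?v ` space (std_space p)"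
  have v: "?v \<in> {v \<in> words p. length v = k}"
    using b by (auto simp: words_def space_std)
  have "b = branch std_inverse ?v (\<lambda>i. b (i + k))" "b' = branch std_inverse ?v (\<lambda>i. b' (i + k))"
    using agree by (auto simp: branch_std_inverse fun_eq_iff)
  moreover have "(\<lambda>i. b (i + k)) \<in> space (std_space p)" "(\<lambda>i. b' (i + k)) \<in> space (std_space p)"
    using b by (auto simp: space_std)
  ultimately have C: "b \<in> ?C" "b' \<in> ?C" by blast+
  have uniform: "uniform_dist \<phi> \<psi> \<le> D" for \<phi> \<psi> :: "'z \<Rightarrow> 'z"
    unfolding uniform_dist_def by (intro cSUP_least D) auto
  have "dist (f b z) (f b' z) \<le> uniform_dist (f b) (f b')"
    unfolding uniform_dist_def using D by (intro cSUP_upper bdd_aboveI2) auto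
  also have "\<dots> \<le> uniform_diameter (f ` ?C)"
    unfolding uniform_diameter_def
    by (rule cSUP_upper2[where x = "(f b, f b')"]) (use C uniform in \<open>auto intro!: bdd_aboveI2\<close>)
  also have "\<dots> \<le> cocycle_variation p f k"
    unfolding cocycle_variation_def
    using finite_level[of p k] by (intro cSUP_upper v) (simp add: level_def)
  finally show ?thesis .
qed

text \<open>Applying the isometry \<open>f b\<close> to both points turns the distance of the
  inverses at \<open>z\<close> into the distance of \<open>f b'\<close> and \<open>f b\<close> at
  the single point \<open>inv (f b') z\<close>.\<close>

lemma dist_inv_cocycle_le:
  assumes b: "b \<in> space (std_space p)" "b' \<in> space (std_space p)" and agree: "\<And>i. i < k \<Longrightarrow> b i = b' i"
  shows "dist (inv (f b) z) (inv (f b') z) \<le> cocycle_variation p f k"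
proof -
  note I = f_isometries[OF b(1)] and I' = f_isometries[OF b(2)]
  have "dist (inv (f b) z) (inv (f b') z) = dist (f b (inv (f b) z)) (f b (inv (f b') z))"
    by (simp only: isometryD(2)[OF I])
  also have "\<dots> = dist (f b' (inv (f b') z)) (f b (inv (f b') z))"
    by (simp only: isometry_inverse(2)[OF I] isometry_inverse(2)[OF I'])
  also have "\<dots> \<le> cocycle_variation p f k"
    using agree by (intro dist_cocycle_le b) simp
  finally show ?thesis .
qed

lemma variation_nonneg: "0 \<le> cocycle_variation p f k"
proof -
  have b: "(\<lambda>_. 0) \<in> space (std_space p)" using p_pos by (simp add: space_std)
  show ?thesis using dist_cocycle_le[OF b b] zero_le_dist order_trans by blast
qed

lemma summable_variation: "summable (\<lambda>j. cocycle_variation p f (j + k))"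
  using summable by (simp add: summable_cocycle_def summable_iff_shift)

lemma tail_nonneg: "0 \<le> tail k"
  unfolding tail_def using summable_variation variation_nonneg by (intro suminf_nonneg)

lemma tail_Suc: "tail k = cocycle_variation p f k + tail (Suc k)"
  using suminf_split_head[OF summable_variation[of k]] by (simp add: tail_def)

lemma tail_tendsto_0: "tail \<longlonglongrightarrow> 0"
  unfolding tail_def using summable
  by (intro suminf_exist_split2) (simp add: summable_cocycle_def)

section \<open>The maps \<open>S i\<close> as inverse branches of \<open>T\<close>\<close>

lemma std_inverse_space:
  "i < p \<Longrightarrow> b \<in> space (std_space p) \<Longrightarrow> std_inverse i b \<in> space (std_space p)"
  by (auto simp: space_std std_inverse_def split: nat.splits)

lemma S_space: "i < p \<Longrightarrow> x \<in> space M \<Longrightarrow> S i x \<in> space M"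
  by (auto simp: space_M S_def std_inverse_def split: nat.splits)

lemma T_space: "x \<in> space M \<Longrightarrow> T x \<in> space M"
  by (auto simp: space_M T_def cocycle_extension_def std_shift_def split: prod.splits)

lemma Tn_space: "x \<in> space M \<Longrightarrow> (T ^^ n) x \<in> space M"
  by (induction n) (auto simp: T_space)

lemma fst_Tn: "fst ((T ^^ n) x) = (\<lambda>i. fst x (i + n))"
  by (induction n) (auto simp: T_def cocycle_extension_def std_shift_def split: prod.splits)

lemma T_S:
  assumes "i < p" "x \<in> space M"
  shows "T (S i x) = x"
proof -
  have "std_inverse i (fst x) \<in> space (std_space p)"
    using assms by (intro std_inverse_space) (auto simp: space_M space_std)
  from isometry_inverse(2)[OF f_isometries[OF this]] show ?thesis
    by (simp add: T_def S_def cocycle_extension_def std_inverse_def std_shift_def prod_eq_iff)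
qed

lemma S_T:
  assumes "x \<in> space M"
  shows "S (fst x 0) (T x) = x"
proof -
  have "fst x \<in> space (std_space p)" using assms by (simp add: space_M space_std)
  from isometry_inverse(1)[OF f_isometries[OF this]]
  have "inv (f (fst x)) (f (fst x) (snd x)) = snd x" .
  moreover have "std_inverse (fst x 0) (std_shift (fst x)) = fst x"
    by (auto simp: std_inverse_def std_shift_def fun_eq_iff split: nat.splits)
  ultimately show ?thesis
    by (simp add: T_def S_def cocycle_extension_def prod_eq_iff split: prod.splits)
qed

lemma T_eq_iff:
  assumes "x \<in> space M" "y \<in> space M"
  shows "T y = x \<longleftrightarrow> y = S (fst y 0) x"
  using S_T[OF assms(2)] T_S[of "fst y 0" x] assms by (auto simp: space_M)

lemma S_eq_iff: "S i x = S j x \<longleftrightarrow> i = j"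
proof -
  have "i = j" if eq: "std_inverse i b = std_inverse j b" for b
    using arg_cong[OF eq, of "\<lambda>b. b 0"] by (simp add: std_inverse_def)
  then show ?thesis by (auto simp: S_def)
qed

text \<open>The way back from the \<open>n\<close>-th image: the symbols dropped by the shift are
  restored in the opposite order, the last dropped one first.\<close>

lemma branch_S_Tn:
  assumes "x \<in> space M"
  shows "branch S (rev (map (fst x) [0..<n])) ((T ^^ n) x) = x"
  using assms
proof (induction n arbitrary: x)
  case (Suc n)
  have "map (fst x) [0..<Suc n] = fst x 0 # map (fst (T x)) [0..<n]"
    using fst_Tn[of 1 x] by (auto simp: map_upt_Suc simp del: upt_Suc)
  then have "branch S (rev (map (fst x) [0..<Suc n])) ((T ^^ Suc n) x)
      = S (fst x 0) (branch S (rev (map (fst (T x)) [0..<n])) ((T ^^ n) (T x)))"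
    by (simp add: funpow_swap1 del: upt_Suc)
  also have "\<dots> = x" using Suc by (simp add: T_space S_T)
  finally show ?case .
qed simp

lemma close_S:
  assumes "x \<in> space M" "y \<in> space M" "i < p" "close k d x y"
  shows "close (Suc k) (d + cocycle_variation p f (Suc k)) (S i x) (S i y)"
proof -
  let ?b = "std_inverse i (fst x)" and ?b' = "std_inverse i (fst y)"
  have b: "?b \<in> space (std_space p)" "?b' \<in> space (std_space p)"
    using assms by (auto intro!: std_inverse_space fst_space)
  have agree: "?b j = ?b' j" if "j < Suc k" for j
    using assms that by (auto simp: close_def std_inverse_def split: nat.splits)
  \<comment> \<open>The intermediate point separates the two effects: one isometry applied to two
    fibre points preserves their distance, and two isometries at one point differ by the variation
    at \<open>k + 1\<close> symbols.\<close>
  have "dist (inv (f ?b) (snd x)) (inv (f ?b') (snd y))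
      \<le> dist (inv (f ?b) (snd x)) (inv (f ?b) (snd y)) + dist (inv (f ?b) (snd y)) (inv (f ?b') (snd y))"
    by (rule dist_triangle)
  also have "dist (inv (f ?b) (snd x)) (inv (f ?b) (snd y)) = dist (snd x) (snd y)"
    by (intro isometryD isometry_inverse f_isometries b)
  also have "dist (inv (f ?b) (snd y)) (inv (f ?b') (snd y)) \<le> cocycle_variation p f (Suc k)"
    using agree by (intro dist_inv_cocycle_le b)
  finally show ?thesis using assms agree by (auto simp: close_def S_def)
qed

text \<open>Both \<open>k\<close> and \<open>d\<close> vary in the induction: each letter moves the
  first term of the tail into \<open>d\<close>, so the total is the same for words of every
  length.\<close>

lemma close_branch:
  assumes "x \<in> space M" "y \<in> space M" "v \<in> words p" "close k d x y"
  shows "close (k + length v) (d + tail (Suc k)) (branch S v x) (branch S v y)"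
  using assms
proof (induction v arbitrary: x y k d)
  case Nil
  then show ?case using tail_nonneg[of "Suc k"] by (auto simp: close_def)
next
  case (Cons i v)
  then have "close (Suc k + length v) (d + cocycle_variation p f (Suc k) + tail (Suc (Suc k)))
      (branch S v (S i x)) (branch S v (S i y))"
    by (intro Cons.IH close_S S_space) auto
  then show ?case by (simp add: tail_Suc[of "Suc k"] add.assoc)
qed

section \<open>Measurability of the extension and of its inverse branches\<close>

lemma coordinate_measurable [measurable]: "(\<lambda>b. b i) \<in> std_space p \<rightarrow>\<^sub>M count_space UNIV"
proof -
  have "(\<lambda>b. b i) \<in> std_space p \<rightarrow>\<^sub>M uniform_count_measure {..<p}"
    unfolding std_space_def by (rule measurable_component_singleton) simp
  then have "(\<lambda>b. b i) \<in> std_space p \<rightarrow>\<^sub>M count_space {..<p}"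
    by (simp add: measurable_cong_sets[OF refl sets_uniform_count_measure_count_space])
  from measurable_compose[OF this measurable_count_space[of "\<lambda>x. x"]] show ?thesis .
qed

lemma map_coordinates_measurable [measurable]:
  "(\<lambda>b. map b xs) \<in> std_space p \<rightarrow>\<^sub>M count_space UNIV"
proof (induction xs)
  case (Cons i xs)
  have "(\<lambda>b. a # map b xs) \<in> std_space p \<rightarrow>\<^sub>M count_space UNIV" for a
    using measurable_compose[OF Cons measurable_count_space[of "(#) a"]] .
  from measurable_compose_countable[OF this coordinate_measurable[of i]] show ?case by simp
qed simp

text \<open>The coordinates generate the product sigma-algebra. The source \<open>N\<close> is
  arbitrary because the lemma is also applied to auxiliary sigma-algebras on the product space that
  are to be shown to contain \<open>sets M\<close>.\<close>

lemma measurable_into_std: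
  assumes "\<And>i. (\<lambda>x. h x i) \<in> N \<rightarrow>\<^sub>M count_space UNIV"
    and "\<And>x. x \<in> space N \<Longrightarrow> h x \<in> space (std_space p)"
  shows "h \<in> N \<rightarrow>\<^sub>M std_space p"
proof -
  have "(\<lambda>x. h x i) \<in> N \<rightarrow>\<^sub>M count_space {..<p}" for i
    by (rule measurable_count_space_extend[OF subset_UNIV _ assms(1)])
       (use assms(2) in \<open>auto simp: space_std\<close>)
  then have "(\<lambda>x. h x i) \<in> N \<rightarrow>\<^sub>M uniform_count_measure {..<p}" for i
    by (simp add: measurable_cong_sets[OF refl sets_uniform_count_measure_count_space])
  then have "(\<lambda>x i. h x i) \<in> N \<rightarrow>\<^sub>M (\<Pi>\<^sub>M i\<in>UNIV. uniform_count_measure {..<p})"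
    using assms(2) by (intro measurable_PiM_single')
      (auto simp: space_std space_uniform_count_measure)
  then show ?thesis by (simp add: std_space_def)
qed

lemma std_shift_measurable [measurable]: "std_shift \<in> std_space p \<rightarrow>\<^sub>M std_space p"
  by (rule measurable_into_std) (auto simp: std_shift_def space_std)

lemma std_inverse_measurable: "i < p \<Longrightarrow> std_inverse i \<in> std_space p \<rightarrow>\<^sub>M std_space p"
proof (rule measurable_into_std)
  fix j show "(\<lambda>b. std_inverse i b j) \<in> std_space p \<rightarrow>\<^sub>M count_space UNIV"
    by (cases j) (auto simp: std_inverse_def)
qed (rule std_inverse_space)

lemma fst_measurable_M [measurable]: "fst \<in> M \<rightarrow>\<^sub>M std_space p"
  by (simp add: M_def)

lemma snd_measurable_M: "snd \<in> M \<rightarrow>\<^sub>M m"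
  by (simp add: M_def)

lemma snd_borel_measurable [measurable]: "snd \<in> borel_measurable M"
  using snd_measurable_M by (simp add: measurable_cong_sets[OF refl sets_m])

text \<open>Joint measurability comes from the variation: keeping the first \<open>k\<close> symbols
  and continuing with 0 changes the map by at most the \<open>k\<close>-th variation, which tends to
  0. Each approximation depends on a word from a countable set and is continuous in the fibre for a
  fixed word.\<close>

lemma fiber_map_measurable:
  assumes cont: "\<And>b. b \<in> space (std_space p) \<Longrightarrow> continuous_on UNIV (F b)"
    and close: "\<And>b b' k z. b \<in> space (std_space p) \<Longrightarrow> b' \<in> space (std_space p) \<Longrightarrow>
      (\<And>i. i < k \<Longrightarrow> b i = b' i) \<Longrightarrow> dist (F b z) (F b' z) \<le> cocycle_variation p f k"
  shows "(\<lambda>x. F (fst x) (snd x)) \<in> M \<rightarrow>\<^sub>M m"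
proof -
  define ext where "ext w = (\<lambda>i. if i < length w then w ! i else 0)" for w :: "nat list"
  have ext: "ext (map b [0..<k]) \<in> space (std_space p)" if "b \<in> space (std_space p)" for b k
    using that p_pos by (auto simp: ext_def space_std)
  have "(\<lambda>x. F (fst x) (snd x)) \<in> borel_measurable M"
  proof (rule borel_measurable_LIMSEQ_metric)
    fix k
    \<comment> \<open>The second alternative is a default for words with letters outside the
      alphabet; it never occurs for prefixes of points of the space.\<close>
    let ?g = "\<lambda>w x. if ext w \<in> space (std_space p) then F (ext w) (snd x) else snd x"
    have "?g w \<in> borel_measurable M" for w
      using measurable_compose[OF snd_borel_measurable borel_measurable_continuous_onI[OF cont]]
      by (cases "ext w \<in> space (std_space p)") auto
    moreover have "(\<lambda>x. map (fst x) [0..<k]) \<in> M \<rightarrow>\<^sub>M count_space UNIV" by measurable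
    ultimately show "(\<lambda>x. ?g (map (fst x) [0..<k]) x) \<in> borel_measurable M"
      by (rule measurable_compose_countable)
  next
    fix x assume x: "x \<in> space M"
    let ?g = "\<lambda>k. F (ext (map (fst x) [0..<k])) (snd x)"
    have "?g \<longlonglongrightarrow> F (fst x) (snd x)"
    proof (rule metric_tendsto_imp_tendsto)
      show "(\<lambda>k. cocycle_variation p f k) \<longlonglongrightarrow> 0"
        using summable by (simp add: summable_cocycle_def summable_LIMSEQ_zero)
      have "dist (?g k) (F (fst x) (snd x)) \<le> cocycle_variation p f k" for k
        using ext fst_space[OF x] by (intro close) (auto simp: ext_def)
      then show "\<forall>\<^sub>F k in sequentially. dist (?g k) (F (fst x) (snd x)) \<le> dist (cocycle_variation p f k) 0"
        using variation_nonneg by (intro always_eventually allI) auto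
    qed
    then show "(\<lambda>k. if ext (map (fst x) [0..<k]) \<in> space (std_space p)
        then F (ext (map (fst x) [0..<k])) (snd x) else snd x) \<longlonglongrightarrow> F (fst x) (snd x)"
      using ext[OF fst_space[OF x]] by simp
  qed
  then show ?thesis by (simp add: measurable_cong_sets[OF refl sets_m])
qed

lemma T_measurable [measurable]: "T \<in> M \<rightarrow>\<^sub>M M"
proof -
  have "(\<lambda>x. f (fst x) (snd x)) \<in> M \<rightarrow>\<^sub>M m"
    by (intro fiber_map_measurable continuous_isometry f_isometries dist_cocycle_le)
  moreover have "(\<lambda>x. std_shift (fst x)) \<in> M \<rightarrow>\<^sub>M std_space p" by measurable
  ultimately have "(\<lambda>x. (std_shift (fst x), f (fst x) (snd x))) \<in> M \<rightarrow>\<^sub>M std_space p \<Otimes>\<^sub>M m"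
    by (rule measurable_Pair[rotated])
  then show ?thesis by (simp add: T_def cocycle_extension_def M_def split_beta')
qed

lemma S_measurable:
  assumes i: "i < p"
  shows "S i \<in> M \<rightarrow>\<^sub>M M"
proof -
  have "(\<lambda>x. inv (f (std_inverse i (fst x))) (snd x)) \<in> M \<rightarrow>\<^sub>M m"
  proof (rule fiber_map_measurable)
    fix b b' k z
    assume b: "b \<in> space (std_space p)" "b' \<in> space (std_space p)" and "\<And>i. i < k \<Longrightarrow> b i = b' i"
    then have "dist (inv (f (std_inverse i b)) z) (inv (f (std_inverse i b')) z)
        \<le> cocycle_variation p f k"
      using i by (intro dist_inv_cocycle_le std_inverse_space)
        (auto simp: std_inverse_def split: nat.splits)
    then show "dist (inv (f (std_inverse i b)) z) (inv (f (std_inverse i b')) z)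
        \<le> cocycle_variation p f k" .
  qed (intro continuous_isometry isometry_inverse f_isometries std_inverse_space i)
  moreover have "(\<lambda>x. std_inverse i (fst x)) \<in> M \<rightarrow>\<^sub>M std_space p"
    by (rule measurable_compose[OF fst_measurable_M std_inverse_measurable[OF i]])
  ultimately show ?thesis
    unfolding S_def[abs_def] by (subst (2) M_def) (rule measurable_Pair)
qed

lemma K_sets: "K i \<in> sets M"
  unfolding K_def by measurable

section \<open>Invariance of the product measure\<close>

lemma prob_std: "prob_space (std_space p)"
  unfolding std_space_def
  using p_pos by (intro prob_space_PiM prob_space_uniform_count_measure) auto

lemma prob_M: "prob_space M"
proof -
  interpret pair_prob_space "std_space p" m
    using prob_std prob_m by (simp add: pair_prob_space_def pair_sigma_finite_def prob_space_imp_sigma_finite)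
  show ?thesis unfolding M_def by unfold_locales
qed

text \<open>A sequence of independent uniform symbols is a uniform first symbol together with an
  independent sequence of the same law.\<close>

lemma nn_integral_std_split:
  assumes h: "h \<in> borel_measurable (std_space p)"
  shows "(\<integral>\<^sup>+b. h b \<partial>std_space p) = (\<Sum>i<p. \<integral>\<^sup>+b. h (std_inverse i b) \<partial>std_space p) / p"
proof -
  let ?u = "uniform_count_measure {..<p}"
  interpret u: prob_space ?u using p_pos by (intro prob_space_uniform_count_measure) auto
  interpret seq: sequence_space ?u by unfold_locales
  interpret nu: prob_space "std_space p" by (rule prob_std)
  have std: "std_space p = seq.S" by (simp add: std_space_def)
  have meas: "(\<lambda>(s, \<omega>). case_nat s \<omega>) \<in> ?u \<Otimes>\<^sub>M std_space p \<rightarrow>\<^sub>M std_space p"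
    unfolding std by measurable
  have "(\<integral>\<^sup>+b. h b \<partial>std_space p)
      = (\<integral>\<^sup>+b. h b \<partial>distr (?u \<Otimes>\<^sub>M std_space p) (std_space p) (\<lambda>(s, \<omega>). case_nat s \<omega>))"
    using seq.PiM_iter by (simp add: std)
  also have "\<dots> = (\<integral>\<^sup>+x. h (case_nat (fst x) (snd x)) \<partial>(?u \<Otimes>\<^sub>M std_space p))"
    by (subst nn_integral_distr[OF meas]) (use h in \<open>simp_all add: split_beta'\<close>)
  also have "\<dots> = (\<integral>\<^sup>+i. \<integral>\<^sup>+b. h (case_nat i b) \<partial>std_space p \<partial>?u)"
    using measurable_compose[OF meas h]
    by (subst nu.nn_integral_fst[symmetric]) (auto simp: split_beta')
  also have "\<dots> = (\<Sum>i<p. ennreal (1 / p) * (\<integral>\<^sup>+b. h (case_nat i b) \<partial>std_space p))"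
    unfolding uniform_count_measure_def
    by (subst nn_integral_point_measure_finite) auto
  also have "\<dots> = (\<Sum>i<p. \<integral>\<^sup>+b. h (std_inverse i b) \<partial>std_space p) / p"
    using p_pos
    by (simp add: std_inverse_def sum_distrib_left[symmetric] divide_ennreal_def mult.commute
        inverse_ennreal ennreal_of_nat_eq_real_of_nat flip: inverse_eq_divide)
  finally show ?thesis .
qed

text \<open>By Fubini the claim is reduced to fibres. The base contributes the average over the
  first symbol, and over each base point the branch acts by an isometry, which preserves
  \<open>m\<close>.\<close>

lemma emeasure_M_split:
  assumes A: "A \<in> sets M"
  shows "emeasure M A = (\<Sum>i<p. emeasure M (S i -` A \<inter> space M)) / p"
proof -
  interpret m: prob_space m by (rule prob_m)
  have alt: "emeasure M B = (\<integral>\<^sup>+b. emeasure m (Pair b -` B) \<partial>std_space p)" if "B \<in> sets M" for B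
    using that unfolding M_def by (rule m.emeasure_pair_measure_alt)
  have fiber: "emeasure m (Pair (std_inverse i b) -` A) = emeasure m (Pair b -` (S i -` A \<inter> space M))"
    if i: "i < p" and b: "b \<in> space (std_space p)" for i b
  proof -
    let ?\<phi> = "inv (f (std_inverse i b))"
    have iso: "?\<phi> \<in> isometries" using i b by (intro isometry_inverse f_isometries std_inverse_space)
    have "Pair (std_inverse i b) -` A \<in> sets m"
      using A unfolding M_def by (rule sets_Pair1)
    then have "emeasure (distr m m ?\<phi>) (Pair (std_inverse i b) -` A)
        = emeasure m (?\<phi> -` (Pair (std_inverse i b) -` A) \<inter> space m)"
      by (intro emeasure_distr isometry_measurable iso)
    also have "?\<phi> -` (Pair (std_inverse i b) -` A) \<inter> space m = Pair b -` (S i -` A \<inter> space M)"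
      using b by (auto simp: S_def space_M space_std)
    finally show ?thesis using invariant iso by simp
  qed
  have meas: "S i -` A \<inter> space M \<in> sets M" if "i < p" for i
    using S_measurable[OF that] A by (rule measurable_sets)
  have "emeasure M A = (\<Sum>i<p. \<integral>\<^sup>+b. emeasure m (Pair (std_inverse i b) -` A) \<partial>std_space p) / p"
    unfolding alt[OF A]
    using A m.measurable_emeasure_Pair unfolding M_def by (intro nn_integral_std_split)
  also have "(\<Sum>i<p. \<integral>\<^sup>+b. emeasure m (Pair (std_inverse i b) -` A) \<partial>std_space p)
      = (\<Sum>i<p. emeasure M (S i -` A \<inter> space M))"
    using fiber by (intro sum.cong refl) (auto simp: alt[OF meas] intro!: nn_integral_cong)
  finally show ?thesis .
qed

lemma measure_M_split:
  assumes A: "A \<in> sets M"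
  shows "measure M A = (\<Sum>i<p. measure M (S i -` A \<inter> space M)) / p"
proof -
  interpret prob_space M by (rule prob_M)
  have "ennreal (measure M A) = ennreal ((\<Sum>i<p. measure M (S i -` A \<inter> space M)) / p)"
    using emeasure_M_split[OF A] p_pos
    by (simp add: emeasure_eq_measure divide_ennreal sum_nonneg ennreal_of_nat_eq_real_of_nat)
  then show ?thesis by (subst (asm) ennreal_inj) (auto intro!: divide_nonneg_nonneg sum_nonneg)
qed

text \<open>Since \<open>S i\<close> is a right inverse of \<open>T\<close>, every branch pulls the
  preimage of \<open>A\<close> back to \<open>A\<close> itself, and the average of equal numbers
  remains.\<close>

lemma T_measure_preserving: "measure_preserving_map M T"
proof -
  interpret prob_space M by (rule prob_M)
  have "distr M M T = M"
  proof (rule measure_eqI)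
    fix A assume "A \<in> sets (distr M M T)"
    then have A: "A \<in> sets M" by simp
    have "measure M (T -` A \<inter> space M) = (\<Sum>i<p. measure M (S i -` (T -` A \<inter> space M) \<inter> space M)) / p"
      using A by (intro measure_M_split measurable_sets[OF T_measurable])
    also have "\<dots> = (\<Sum>i<p. measure M A) / p"
    proof (intro arg_cong[where f = "\<lambda>t. t / real p"] sum.cong refl)
      fix i assume i: "i \<in> {..<p}"
      have "x \<in> S i -` (T -` A \<inter> space M) \<inter> space M \<longleftrightarrow> x \<in> A" for x
        using i T_S[of i x] S_space[of i x] sets.sets_into_space[OF A] by (cases "x \<in> space M") auto
      then have "S i -` (T -` A \<inter> space M) \<inter> space M = A" by blast
      then show "measure M (S i -` (T -` A \<inter> space M) \<inter> space M) = measure M A" by simp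
    qed
    also have "\<dots> = measure M A" using p_pos by simp
    finally show "emeasure (distr M M T) A = emeasure M A"
      using A by (simp add: emeasure_distr emeasure_eq_measure)
  qed simp
  then show ?thesis by (simp add: measure_preserving_map_def)
qed

section \<open>Fibres of \<open>T\<close> and the conditional expectation\<close>

lemma fiber_eq:
  assumes A: "A \<subseteq> space M" and x: "x \<in> space M"
  shows "{y \<in> A. T y = x} = (\<lambda>i. S i x) ` {i. i < p \<and> S i x \<in> A}"
proof -
  have "\<exists>i<p. y = S i x \<and> S i x \<in> A" if "y \<in> A" "T y = x" for y
    using T_eq_iff[OF x, of y] that A by (intro exI[of _ "fst y 0"]) (auto simp: space_M)
  then show ?thesis using T_S[OF _ x] by blast
qed

lemma card_fiber:
  assumes A: "A \<subseteq> space M" and x: "x \<in> space M"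
  shows "real (card {y \<in> A. T y = x}) = (\<Sum>i<p. indicator A (S i x))"
proof -
  have "card {y \<in> A. T y = x} = card {i. i < p \<and> S i x \<in> A}"
    unfolding fiber_eq[OF assms] by (intro card_image) (auto simp: inj_on_def S_eq_iff)
  also have "real \<dots> = (\<Sum>i<p. indicator A (S i x))"
    by (simp add: indicator_def sum.If_cases Int_def)
  finally show ?thesis .
qed

text \<open>The candidate is \<open>G\<close> composed with \<open>T\<close>, where
  \<open>G y\<close> is the proportion of preimages of \<open>y\<close> in \<open>A\<close>; it is
  measurable for the pulled-back sigma-algebra. Over the preimage of a set \<open>C\<close> the
  integrals agree because \<open>S i\<close> pulls the intersection of this preimage with
  \<open>A\<close> back to the points of \<open>C\<close> that \<open>S i\<close> sends into
  \<open>A\<close>. Invariance then moves the integral of \<open>G\<close> over \<open>C\<close> to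
  the preimage.\<close>

lemma cond_exp_fiber:
  assumes A: "A \<in> sets M"
  shows "AE x in M. real_cond_exp M (vimage_algebra (space M) T M) (indicator A) x
    = real (card {y \<in> A. T y = T x}) / real p"
proof -
  interpret prob_space M by (rule prob_M)
  let ?F = "vimage_algebra (space M) T M"
  have sub: "subalgebra M ?F"
    using T_measurable by (auto simp: subalgebra_def sets_vimage_algebra2 measurable_def)
  interpret finite_measure_subalgebra M ?F by unfold_locales (rule sub)
  have A_sub: "A \<subseteq> space M" using A by (rule sets.sets_into_space)
  have S_meas [measurable]: "i < p \<Longrightarrow> S i \<in> M \<rightarrow>\<^sub>M M" for i by (rule S_measurable)
  define G where "G y = (\<Sum>i<p. indicator A (S i y)) / real p" for y
  have G [measurable]: "G \<in> borel_measurable M"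
    using A unfolding G_def by (intro borel_measurable_divide borel_measurable_sum) auto
  have G_T: "G (T x) = real (card {y \<in> A. T y = T x}) / real p" if "x \<in> space M" for x
    using card_fiber[OF A_sub T_space[OF that]] by (simp add: G_def)
  have G_bound: "norm (G y) \<le> 1" for y
  proof -
    have "(\<Sum>i<p. indicator A (S i y)) \<le> (\<Sum>i<p. 1 :: real)" by (intro sum_mono) (simp add: indicator_def)
    then show ?thesis using p_pos by (simp add: G_def sum_nonneg)
  qed
  have int_G: "integrable M G" using G_bound by (intro integrable_const_bound[of _ 1]) auto
  have int_GT: "integrable M (\<lambda>x. G (T x))"
    using G_bound by (intro integrable_const_bound[of _ 1]) auto
  have "AE x in M. real_cond_exp M ?F (indicator A) x = G (T x)"
  proof (rule real_cond_exp_charact)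
    fix E assume "E \<in> sets ?F"
    then obtain C where C: "C \<in> sets M" "E = T -` C \<inter> space M"
      using T_measurable by (auto simp: sets_vimage_algebra2 measurable_def)
    have E: "E \<in> sets M" using C T_measurable by (auto intro: measurable_sets)
    have "(\<integral>x\<in>E. indicator A x \<partial>M) = measure M (E \<inter> A)"
    proof -
      have "(\<integral>x\<in>E. indicator A x \<partial>M) = (\<integral>x. indicator (E \<inter> A) x \<partial>M)"
        unfolding set_lebesgue_integral_def
        by (intro Bochner_Integration.integral_cong) (auto simp: indicator_def)
      also have "\<dots> = measure M (E \<inter> A)" using E A by simp
      finally show ?thesis .
    qed
    also have "\<dots> = (\<Sum>i<p. measure M (S i -` (E \<inter> A) \<inter> space M)) / p"
      using E A by (intro measure_M_split) auto
    also have "\<dots> = (\<Sum>i<p. (\<integral>x. indicator C x * indicator A (S i x) \<partial>M)) / p"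
    proof (intro arg_cong[where f = "\<lambda>t. t / real p"] sum.cong refl)
      fix i assume i: "i \<in> {..<p}"
      have "measure M (S i -` (E \<inter> A) \<inter> space M) = (\<integral>x. indicator (S i -` (E \<inter> A) \<inter> space M) x \<partial>M)"
        by (simp add: Int_assoc)
      also have "\<dots> = (\<integral>x. indicator C x * indicator A (S i x) \<partial>M)"
        using i C T_S[of i] S_space[of i]
        by (intro Bochner_Integration.integral_cong) (auto simp: indicator_def)
      finally show "measure M (S i -` (E \<inter> A) \<inter> space M)
          = (\<integral>x. indicator C x * indicator A (S i x) \<partial>M)" .
    qed
    also have "\<dots> = (\<integral>x. indicator C x * G x \<partial>M)"
    proof -
      have "integrable M (\<lambda>x. indicator C x * indicator A (S i x) :: real)" if "i < p" for i
        using that C A by (intro integrable_const_bound[of _ 1]) (auto simp: indicator_def)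
      then have "(\<integral>x. (\<Sum>i<p. indicator C x * indicator A (S i x)) \<partial>M)
          = (\<Sum>i<p. (\<integral>x. indicator C x * indicator A (S i x) \<partial>M) :: real)"
        by (intro Bochner_Integration.integral_sum) auto
      then show ?thesis
        by (simp only: G_def times_divide_eq_right sum_distrib_left integral_divide_zero)
    qed
    also have "\<dots> = (\<integral>x. indicator C x * G x \<partial>distr M M T)"
      using T_measure_preserving by (simp add: measure_preserving_map_def)
    also have "\<dots> = (\<integral>x. indicator C (T x) * G (T x) \<partial>M)"
      using C by (intro integral_distr) auto
    also have "\<dots> = (\<integral>x\<in>E. G (T x) \<partial>M)"
      unfolding set_lebesgue_integral_def C
      by (intro Bochner_Integration.integral_cong) (auto simp: indicator_def)
    finally show "(\<integral>x\<in>E. indicator A x \<partial>M) = (\<integral>x\<in>E. G (T x) \<partial>M)" .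
  next
    show "integrable M (indicator A :: _ \<Rightarrow> real)"
      using A by (intro integrable_const_bound[of _ 1]) auto
    show "(\<lambda>x. G (T x)) \<in> borel_measurable ?F"
      by (rule measurable_compose[OF measurable_vimage_algebra1 G]) (rule funcsetI[OF T_space])
  qed (rule int_GT)
  then show ?thesis using AE_space by eventually_elim (simp add: G_T)
qed

lemma card_preimages: "x \<in> space M \<Longrightarrow> card {y \<in> space M. T y = x} = p"
  using card_fiber[of "space M" x] S_space by (auto simp: indicator_def sum.If_cases)

lemma preimage_in_K:
  assumes "i < p" "x \<in> space M"
  shows "y \<in> K i \<and> T y = x \<longleftrightarrow> y = S i x"
  using T_eq_iff[OF assms(2), of y] S_space[OF assms] assms
  by (auto simp: K_def S_def std_inverse_def)

lemma preimage_partition: "preimage_partition p M T K"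
  unfolding preimage_partition_def
proof (intro conjI allI impI)
  show "disjoint_family_on K {..<p}" by (auto simp: disjoint_family_on_def K_def)
  show "(\<Union>i<p. K i) = space M" by (auto simp: K_def space_M)
  show "AE x in M. \<forall>i<p. \<exists>!y. y \<in> K i \<and> T y = x"
    by (intro AE_I2) (auto simp: preimage_in_K)
qed (rule K_sets)

lemma partial_inverse_eq: "i < p \<Longrightarrow> x \<in> space M \<Longrightarrow> partial_inverse T K i x = S i x"
  unfolding partial_inverse_def by (simp add: preimage_in_K)

lemma branch_partial_inverse:
  assumes "v \<in> words p" "x \<in> space M"
  shows "branch (partial_inverse T K) v x = branch S v x"
  using assms by (induction v arbitrary: x) (auto simp: partial_inverse_eq S_space)

lemma branch_S_space: "v \<in> words p \<Longrightarrow> x \<in> space M \<Longrightarrow> branch S v x \<in> space M"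
  using S_space by (rule branch_closed)

end

section \<open>Tree names\<close>

text \<open>If some member of \<open>F\<close> were missed at every time, its deviation at that time
  would be the full product of measures, hence at least \<eta>. The missed member may change with
  time, so the deviations are summed over \<open>F\<close>; their Cesaro means would stay above
  \<eta> although each of the finitely many tends to 0.\<close>

lemma weakly_mixing_common_time:
  assumes wm: "weakly_mixing M T" and F: "finite F" "\<And>U. U \<in> F \<Longrightarrow> U \<in> sets M \<and> 0 < measure M U"
    and C: "C \<in> sets M" "0 < measure M C"
  shows "\<exists>n. \<forall>U\<in>F. (T ^^ n) -` U \<inter> C \<noteq> {}"
proof (rule ccontr)
  assume no: "\<not> ?thesis"
  then have "F \<noteq> {}" by auto
  define \<eta> where "\<eta> = Min ((\<lambda>U. measure M U * measure M C) ` F)"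
  have \<eta>: "0 < \<eta>" unfolding \<eta>_def using F C \<open>F \<noteq> {}\<close> by (subst Min_gr_iff) auto
  let ?dev = "\<lambda>U k. \<bar>measure M ((T ^^ k) -` U \<inter> C) - measure M U * measure M C\<bar>"
  have dev: "\<eta> \<le> (\<Sum>U\<in>F. ?dev U k)" for k
  proof -
    obtain U where U: "U \<in> F" "(T ^^ k) -` U \<inter> C = {}" using no by blast
    have "\<eta> \<le> measure M U * measure M C" unfolding \<eta>_def using U F by (intro Min_le) auto
    also have "\<dots> = ?dev U k" using U by (simp add: abs_mult)
    also have "\<dots> \<le> (\<Sum>U\<in>F. ?dev U k)" using F U by (intro member_le_sum) auto
    finally show ?thesis .
  qed
  have "(\<lambda>n. (\<Sum>k<n. ?dev U k) / real n) \<longlonglongrightarrow> 0" if "U \<in> F" for U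
    using wm that F C unfolding weakly_mixing_def by blast
  then have "(\<lambda>n. \<Sum>U\<in>F. (\<Sum>k<n. ?dev U k) / real n) \<longlonglongrightarrow> (\<Sum>U\<in>F. 0)"
    by (rule tendsto_sum)
  then have "(\<lambda>n. \<Sum>U\<in>F. (\<Sum>k<n. ?dev U k) / real n) \<longlonglongrightarrow> 0" by simp
  moreover have "\<forall>\<^sub>F n in sequentially. \<eta> \<le> (\<Sum>U\<in>F. (\<Sum>k<n. ?dev U k) / real n)"
    using eventually_gt_at_top[of 0]
  proof eventually_elim
    fix n :: nat assume n: "0 < n"
    have "real n * \<eta> = (\<Sum>k<n. \<eta>)" by simp
    also have "\<dots> \<le> (\<Sum>k<n. \<Sum>U\<in>F. ?dev U k)" by (intro sum_mono dev)
    also have "\<dots> = (\<Sum>U\<in>F. \<Sum>k<n. ?dev U k)" by (rule sum.swap)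
    finally have "real n * \<eta> / real n \<le> (\<Sum>U\<in>F. \<Sum>k<n. ?dev U k) / real n"
      by (intro divide_right_mono) auto
    then show "\<eta> \<le> (\<Sum>U\<in>F. (\<Sum>k<n. ?dev U k) / real n)"
      using n by (simp add: sum_divide_distrib)
  qed
  ultimately have "\<eta> \<le> 0" by (intro tendsto_lowerbound) auto
  with \<eta> show False by simp
qed

context summable_extension
begin

section \<open>Cells of positive measure and hitting times\<close>

lemma finite_net:
  assumes "0 < d"
  shows "\<exists>Q :: 'z set. finite Q \<and> (\<forall>z. \<exists>q\<in>Q. dist z q < d)"
proof -
  have "\<exists>Q. finite Q \<and> (UNIV :: 'z set) \<subseteq> (\<Union>q\<in>Q. ball q d)"
    using compact_UNIV assms unfolding compact_eq_totally_bounded by blast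
  then obtain Q where Q: "finite Q" "(UNIV :: 'z set) \<subseteq> (\<Union>q\<in>Q. ball q d)" by (elim exE conjE)
  have "\<exists>q\<in>Q. dist z q < d" for z
  proof -
    from subsetD[OF Q(2) UNIV_I[of z]] obtain q where "q \<in> Q" "z \<in> ball q d" by (rule UN_E)
    then show ?thesis by (intro bexI[of _ q]) (simp_all add: dist_commute)
  qed
  with Q(1) show ?thesis by (intro exI[of _ Q] conjI allI)
qed

text \<open>Transitivity gives all balls of radius \<open>d\<close> the same measure, and finitely
  many of them cover the fibre, so this measure is not 0.\<close>

lemma measure_ball_pos:
  assumes "0 < d"
  shows "0 < measure m (ball z d)"
proof -
  interpret m: prob_space m by (rule prob_m)
  have meas: "ball w d \<in> sets m" for w by (simp add: sets_m)
  have eq: "measure m (ball w d) = measure m (ball z d)" for w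
  proof -
    obtain \<phi> where \<phi>: "\<phi> \<in> isometries" "\<phi> z = w" using transitive by blast
    have "measure m (ball w d) = measure (distr m m \<phi>) (ball w d)" using invariant \<phi> by simp
    also have "\<dots> = measure m (\<phi> -` ball w d \<inter> space m)"
      by (intro measure_distr isometry_measurable \<phi> meas)
    also have "\<phi> -` ball w d \<inter> space m = ball z d"
      using isometryD(2)[OF \<phi>(1), of z] \<phi>(2) by auto
    finally show ?thesis .
  qed
  obtain Q :: "'z set" where Q: "finite Q" "\<forall>z. \<exists>q\<in>Q. dist z q < d"
    using finite_net[OF assms] by blast
  have "1 = measure m (\<Union>q\<in>Q. ball q d)"
  proof -
    have "(\<Union>q\<in>Q. ball q d) = space m" using Q by (auto simp: dist_commute)
    then show ?thesis using m.prob_space by simp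
  qed
  also have "\<dots> \<le> (\<Sum>q\<in>Q. measure m (ball q d))"
    using Q meas by (intro m.finite_measure_subadditive_finite) auto
  also have "\<dots> = (\<Sum>q\<in>Q. measure m (ball z d))" by (intro sum.cong refl eq)
  also have "\<dots> = card Q * measure m (ball z d)" by simp
  finally show ?thesis by (cases "measure m (ball z d) = 0") (auto simp: zero_less_measure_iff)
qed

lemma measure_cylinder:
  assumes a: "a \<in> space (std_space p)"
  shows "{b \<in> space (std_space p). \<forall>i<k. b i = a i} \<in> sets (std_space p)"
    and "measure (std_space p) {b \<in> space (std_space p). \<forall>i<k. b i = a i} = (1 / real p) ^ k"
proof -
  let ?u = "uniform_count_measure {..<p}"
  let ?E = "prod_emb UNIV (\<lambda>_. ?u) {..<k} (\<Pi>\<^sub>E i\<in>{..<k}. {a i})"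
  show "{b \<in> space (std_space p). \<forall>i<k. b i = a i} \<in> sets (std_space p)" by measurable
  have "emeasure (std_space p) ?E = (\<Prod>i\<in>{..<k}. emeasure ?u {a i})"
    unfolding std_space_def using a p_pos
    by (intro emeasure_PiM_emb prob_space_uniform_count_measure)
       (auto simp: sets_uniform_count_measure space_std)
  also have "\<dots> = (\<Prod>i\<in>{..<k}. ennreal (1 / real p))"
    using a by (intro prod.cong refl) (auto simp: emeasure_uniform_count_measure space_std)
  also have "\<dots> = ennreal ((1 / real p) ^ k)" by (simp add: ennreal_power)
  also have "?E = {b \<in> space (std_space p). \<forall>i<k. b i = a i}"
    by (auto simp: prod_emb_def space_std space_uniform_count_measure PiE_iff extensional_def
        restrict_def split: if_splits)
  finally show "measure (std_space p) {b \<in> space (std_space p). \<forall>i<k. b i = a i} = (1 / real p) ^ k"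
    by (simp add: measure_def)
qed

lemma measure_cell:
  assumes c: "c \<in> space M" and d: "0 < d"
  shows "{x \<in> space M. close k d x c} \<in> sets M"
    and "0 < measure M {x \<in> space M. close k d x c}"
proof -
  interpret m: prob_space m by (rule prob_m)
  let ?C = "{b \<in> space (std_space p). \<forall>i<k. b i = fst c i}"
  note C = measure_cylinder[OF fst_space[OF c], of k]
  have ball: "ball (snd c) d \<in> sets m" by (simp add: sets_m)
  have eq: "{x \<in> space M. close k d x c} = ?C \<times> ball (snd c) d"
    by (auto simp: close_def space_M space_std dist_commute)
  show "{x \<in> space M. close k d x c} \<in> sets M"
    unfolding eq unfolding M_def using C(1) ball by (rule pair_measureI)
  have "emeasure M (?C \<times> ball (snd c) d) = emeasure (std_space p) ?C * emeasure m (ball (snd c) d)"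
    unfolding M_def using C(1) ball by (rule m.emeasure_pair_measure_Times)
  then have "measure M (?C \<times> ball (snd c) d) = (1 / real p) ^ k * measure m (ball (snd c) d)"
    by (simp add: measure_def enn2real_mult C(2)[unfolded measure_def])
  then show "0 < measure M {x \<in> space M. close k d x c}"
    unfolding eq using measure_ball_pos[OF d] p_pos by simp
qed

lemma finite_cell_cover:
  assumes "0 < d"
  shows "\<exists>F\<subseteq>space M. finite F \<and> (\<forall>x\<in>space M. \<exists>c\<in>F. close k d x c)"
proof -
  obtain Q :: "'z set" where Q: "finite Q" "\<forall>z. \<exists>q\<in>Q. dist z q < d"
    using finite_net[OF assms] by blast
  define ext where "ext w = (\<lambda>i. if i < length w then w ! i else 0)" for w :: "nat list"
  let ?F = "(\<lambda>(w, q). (ext w, q)) ` (level p k \<times> Q)"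
  have "\<exists>c\<in>?F. close k d x c" if x: "x \<in> space M" for x
  proof -
    obtain q where q: "q \<in> Q" "dist (snd x) q < d" using Q by blast
    have "map (fst x) [0..<k] \<in> level p k" using x by (auto simp: level_eq space_M)
    moreover have "close k d x (ext (map (fst x) [0..<k]), q)"
      using q by (simp add: close_def ext_def)
    ultimately show ?thesis using q by (intro bexI[of _ "(ext (map (fst x) [0..<k]), q)"]) auto
  qed
  moreover have "?F \<subseteq> space M"
  proof
    fix x assume "x \<in> ?F"
    then obtain w q where w: "w \<in> level p k" "x = (ext w, q)" by auto
    then have "w ! i < p" if "i < length w" for i using nth_mem[OF that] by (auto simp: level_eq)
    then show "x \<in> space M" using p_pos w(2) by (auto simp: space_M ext_def)
  qed
  ultimately show ?thesis using Q by (intro exI[of _ ?F]) auto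
qed

lemma close_triangle:
  assumes "close k d x y" "close k d' y z"
  shows "close k (d + d') x z"
  using assms dist_triangle[of "snd x" "snd z" "snd y"] by (auto simp: close_def)

lemma close_sym: "close k d x y \<Longrightarrow> close k d y x"
  by (auto simp: close_def dist_commute)

lemma close_mono: "close k d x y \<Longrightarrow> k' \<le> k \<Longrightarrow> d \<le> d' \<Longrightarrow> close k' d' x y"
  by (auto simp: close_def)

text \<open>For a cell centre \<open>c\<close> near \<open>x\<close>, the common time provides a
  point \<open>y\<close> near \<open>c0\<close> whose \<open>n\<close>-th image is near
  \<open>c\<close>. The branch that leads back to \<open>y\<close> is followed from
  \<open>x\<close>. The constant adds \<open>2 * d\<close> for the passage through \<open>c\<close>,
  the tail for the branch, and \<open>d\<close> from \<open>y\<close> to \<open>c0\<close>.\<close>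

lemma common_hitting_time:
  assumes wm: "weakly_mixing M T" and d: "0 < d" and c0: "c0 \<in> space M"
  shows "\<exists>r. \<forall>x\<in>space M. \<exists>v\<in>level p r. close k (3 * d + tail (Suc k)) (branch S v x) c0"
proof -
  obtain F where F: "F \<subseteq> space M" "finite F" "\<forall>x\<in>space M. \<exists>c\<in>F. close k d x c"
    using finite_cell_cover[OF d] by blast
  let ?cell = "\<lambda>c. {x \<in> space M. close k d x c}"
  have "\<exists>n. \<forall>U\<in>?cell ` F. (T ^^ n) -` U \<inter> ?cell c0 \<noteq> {}"
    using F c0 d by (intro weakly_mixing_common_time[OF wm]) (auto intro!: measure_cell)
  then obtain n where n': "\<forall>U\<in>?cell ` F. (T ^^ n) -` U \<inter> ?cell c0 \<noteq> {}" ..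
  have n: "(T ^^ n) -` ?cell c \<inter> ?cell c0 \<noteq> {}" if "c \<in> F" for c
    by (rule bspec[OF n' imageI[OF that]])
  have "\<exists>v\<in>level p n. close k (3 * d + tail (Suc k)) (branch S v x) c0" if x: "x \<in> space M" for x
  proof -
    obtain c where c: "c \<in> F" "close k d x c" using F x by blast
    with n[OF c(1)] obtain y where y: "y \<in> space M" "close k d y c0" "(T ^^ n) y \<in> ?cell c"
      by auto
    let ?v = "rev (map (fst y) [0..<n])"
    have v: "?v \<in> level p n" using y by (auto simp: level_eq space_M)
    have "close k (d + d) x ((T ^^ n) y)"
      using c y close_triangle close_sym by blast
    then have "close (k + length ?v) (d + d + tail (Suc k)) (branch S ?v x) (branch S ?v ((T ^^ n) y))"
      using v y by (intro close_branch x) (auto simp: level_def)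
    then have "close k (d + d + tail (Suc k)) (branch S ?v x) y"
      unfolding branch_S_Tn[OF y(1)] by (rule close_mono) auto
    from close_triangle[OF this y(2)] have "close k (3 * d + tail (Suc k)) (branch S ?v x) c0"
      by (rule close_mono) auto
    with v show ?thesis by blast
  qed
  then show ?thesis by blast
qed

lemma tree_vwB_with_close:
  fixes g :: "(nat \<Rightarrow> nat) \<times> 'z \<Rightarrow> 'r::metric_space"
  assumes wm: "weakly_mixing M T"
    and le1: "\<And>x y. x \<in> space M \<Longrightarrow> y \<in> space M \<Longrightarrow> dist (g x) (g y) \<le> 1"
    and le: "\<And>x y. x \<in> space M \<Longrightarrow> y \<in> space M \<Longrightarrow> fst x 0 = fst y 0 \<Longrightarrow>
      dist (g x) (g y) \<le> dist (snd x) (snd y)"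
  shows "tree_vwB_with p M T K g"
  unfolding tree_vwB_with_def
proof (intro allI impI)
  interpret prob_space M by (rule prob_M)
  fix e :: real assume e: "0 < e"
  obtain c0 where c0: "c0 \<in> space M" using not_empty by blast
  \<comment> \<open>Two points of \<open>D\<close> are within
    \<open>2 * (3 * d + tail (Suc k))\<close>, and following a branch adds one more tail. With tails
    below \<open>d\<close> this stays under \<open>9 * d\<close>, less than
    \<open>e / 3\<close>.\<close>
  define d where "d = e / 48"
  have d: "0 < d" using e by (simp add: d_def)
  have "\<forall>\<^sub>F k in sequentially. tail k < d"
    using tail_tendsto_0 d by (rule order_tendstoD)
  then obtain k0 where k0: "\<And>k. k \<ge> k0 \<Longrightarrow> tail k < d" by (auto simp: eventually_sequentially)
  \<comment> \<open>At least one symbol has to agree, because the Lipschitz bound on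
    \<open>g\<close> applies only to points with the same first symbol.\<close>
  define k where "k = Suc k0"
  have k: "1 \<le> k" "tail (Suc k) < d" using k0 by (auto simp: k_def)
  obtain r where r: "\<And>x. x \<in> space M \<Longrightarrow> \<exists>v\<in>level p r. close k (3 * d + tail (Suc k)) (branch S v x) c0"
    using common_hitting_time[OF wm d c0] by blast
  define D where "D = {x \<in> space M. close k (3 * d + tail (Suc k)) x c0}"
  have hit: "\<exists>v\<in>level p r. branch S v x \<in> D" if "x \<in> space M" for x
    using r[OF that] branch_S_space[OF _ that] by (auto simp: D_def level_def)
  have R: "close 1 (e / 3) (branch S u x) (branch S u y)" if "x \<in> D" "y \<in> D" "u \<in> words p" for x y u
  proof -
    have "close k (2 * (3 * d + tail (Suc k))) x y"
      using close_triangle[of k _ x c0 _ y] close_sym that by (fastforce simp: D_def)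
    then have "close (k + length u) (2 * (3 * d + tail (Suc k)) + tail (Suc k)) (branch S u x) (branch S u y)"
      using that by (intro close_branch) (auto simp: D_def)
    then show ?thesis by (rule close_mono) (use k e in \<open>auto simp: d_def\<close>)
  qed
  have "1 - 1 / real p ^ r < 1" using p_pos by simp
  with e have "\<exists>j. (1 - 1 / real p ^ r) ^ j < e / 3" by (intro real_arch_pow_inv) auto
  then obtain j where j: "(1 - 1 / real p ^ r) ^ j < e / 3" ..
  obtain N0 :: nat where N0: "real (j * r) / (e / 3) < real N0" using reals_Archimedean2 by blast
  show "\<exists>N\<^sub>0. \<forall>N\<ge>N\<^sub>0. \<exists>G\<in>sets M. 1 - e < measure M G \<and>
      (\<forall>x\<in>G. \<forall>y\<in>G. tbar p N (tree_name T K g x) (tree_name T K g y) < e)"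
  \<comment> \<open>The estimate is uniform over all pairs, so the whole space can be taken for the
    large set. The successor keeps \<open>N\<close> positive.\<close>
  proof (intro exI[of _ "Suc N0"] allI impI bexI[of _ "space M"] conjI ballI)
    show "1 - e < measure M (space M)" using e by (simp add: prob_space)
    fix N x y assume N: "N \<ge> Suc N0" and x: "x \<in> space M" and y: "y \<in> space M"
    let ?h = "tree_name T K g x" and ?h' = "tree_name T K g y"
    have "\<exists>A. tree_iso p A \<and> (\<forall>l\<ge>j * r.
        card {u \<in> level p l. \<not> close 1 (e / 3) (branch S u x) (branch S (A u) y)}
          \<le> (1 - 1 / real p ^ r) ^ j * real p ^ l)"
      by (rule ex_tree_iso_few_bad[where R = "close 1 (e / 3)" and \<Omega> = "space M" and D = D])
        (simp_all add: p_pos S_space hit R x y del: One_nat_def)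
    then obtain A where A: "tree_iso p A" and few: "\<forall>l\<ge>j * r.
        card {u \<in> level p l. \<not> close 1 (e / 3) (branch S u x) (branch S (A u) y)}
          \<le> (1 - 1 / real p ^ r) ^ j * real p ^ l" by (elim exE conjE)
    note DA = tree_isoD[OF A]
    have names: "?h u = g (branch S u x)" "?h' (A u) = g (branch S (A u) y)" if "u \<in> words p" for u
      using that DA(1)[OF that] x y by (simp_all add: tree_name_def branch_partial_inverse)
    have sp: "branch S u x \<in> space M" "branch S (A u) y \<in> space M" if "u \<in> words p" for u
      using that DA(1)[OF that] x y by (simp_all add: branch_S_space)
    have "tbar p N ?h ?h' \<le> real (j * r) / real N + (1 - 1 / real p ^ r) ^ j + e / 3"
    proof (rule tbar_le_of_few_bad[OF p_pos _ A])
      show "0 < N" "0 \<le> e / 3" using N e by auto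
      show "0 \<le> (1 - 1 / real p ^ r) ^ j" using p_pos by (intro zero_le_power) simp
      show "dist (?h u) (?h' (A u)) \<le> 1" if "u \<in> words p" for u
        using le1 sp names that by simp
      fix l assume l: "j * r \<le> l"
      have "card {u \<in> level p l. e / 3 < dist (?h u) (?h' (A u))}
          \<le> card {u \<in> level p l. \<not> close 1 (e / 3) (branch S u x) (branch S (A u) y)}"
      proof (intro card_mono subsetI)
        fix u assume u: "u \<in> {u \<in> level p l. e / 3 < dist (?h u) (?h' (A u))}"
        then have uw: "u \<in> words p" by (simp add: level_def)
        have "\<not> close 1 (e / 3) (branch S u x) (branch S (A u) y)"
        proof
          assume "close 1 (e / 3) (branch S u x) (branch S (A u) y)"
          then have "dist (?h u) (?h' (A u)) < e / 3"
            using le[OF sp[OF uw]] by (simp add: names[OF uw] close_def)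
          with u show False by simp
        qed
        with u show "u \<in> {u \<in> level p l. \<not> close 1 (e / 3) (branch S u x) (branch S (A u) y)}"
          by simp
      qed simp
      with few[rule_format, OF l] show "real (card {u \<in> level p l. e / 3 < dist (?h u) (?h' (A u))})
          \<le> (1 - 1 / real p ^ r) ^ j * real p ^ l" by simp
    qed
    moreover have "real (j * r) / real N < e / 3"
    proof -
      have "real (j * r) / (e / 3) < real N" using N0 N by linarith
      then show ?thesis using e N by (simp add: field_simps)
    qed
    ultimately show "tbar p N ?h ?h' < e" using j by linarith
  qed simp
qed

end

section \<open>Entropy of the extension\<close>

lemma simple_function_countable:
  assumes "finite (X ` space N)" "X \<in> N \<rightarrow>\<^sub>M count_space UNIV"
  shows "simple_function N X"
  unfolding simple_function_def
  using assms measurable_sets[OF assms(2)] by auto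

lemma range_unit_intervalD:
  fixes h :: "'a \<Rightarrow> real"
  assumes "range h \<subseteq> {0..1}"
  shows "0 \<le> h x" "h x \<le> 1"
  using subsetD[OF assms rangeI[of h x]] by auto

section \<open>Approximation of measurable sets by uniformly continuous functions\<close>

context summable_extension
begin

definition unif_cont :: "((nat \<Rightarrow> nat) \<times> 'z \<Rightarrow> real) \<Rightarrow> bool" where
  "unif_cont h \<longleftrightarrow> (\<forall>e>0. \<exists>k d. 0 < d \<and>
     (\<forall>x\<in>space M. \<forall>y\<in>space M. close k d x y \<longrightarrow> \<bar>h x - h y\<bar> < e))"

text \<open>Values in the unit interval keep the class stable under products, and thus under
  intersections, and give the constant 1 as a dominating function.\<close>

definition approximable :: "((nat \<Rightarrow> nat) \<times> 'z) set \<Rightarrow> bool" where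
  "approximable A \<longleftrightarrow> A \<in> sets M \<and>
     (\<forall>e>0. \<exists>h \<in> borel_measurable M. unif_cont h \<and> range h \<subseteq> {0..1} \<and>
        (\<integral>x. \<bar>indicator A x - h x\<bar> \<partial>M) < e)"

text \<open>One Lipschitz-type rule covers complements, products, weighted sums and
  truncations.\<close>

lemma unif_cont_combine:
  assumes h: "unif_cont h" "unif_cont h'" and C: "0 \<le> C"
    and le: "\<And>x y. x \<in> space M \<Longrightarrow> y \<in> space M \<Longrightarrow> \<bar>H x - H y\<bar> \<le> C * (\<bar>h x - h y\<bar> + \<bar>h' x - h' y\<bar>)"
  shows "unif_cont H"
  unfolding unif_cont_def
proof (intro allI impI)
  fix e :: real assume e: "0 < e"
  \<comment> \<open>The denominator has \<open>C + 1\<close> because \<open>C\<close> may be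
    0.\<close>
  define e' where "e' = e / (2 * (C + 1))"
  have e': "0 < e'" using e C by (simp add: e'_def)
  obtain k d where kd: "0 < d" "\<And>x y. x \<in> space M \<Longrightarrow> y \<in> space M \<Longrightarrow> close k d x y \<Longrightarrow> \<bar>h x - h y\<bar> < e'"
    using h(1) e' unfolding unif_cont_def by meson
  obtain k' d' where kd': "0 < d'" "\<And>x y. x \<in> space M \<Longrightarrow> y \<in> space M \<Longrightarrow> close k' d' x y \<Longrightarrow> \<bar>h' x - h' y\<bar> < e'"
    using h(2) e' unfolding unif_cont_def by meson
  have "\<bar>H x - H y\<bar> < e" if "x \<in> space M" "y \<in> space M" "close (max k k') (min d d') x y" for x y
  proof -
    have "close k d x y" "close k' d' x y" using that(3) by (auto intro: close_mono)
    then have lt: "\<bar>h x - h y\<bar> + \<bar>h' x - h' y\<bar> \<le> 2 * e'"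
      using kd(2)[of x y] kd'(2)[of x y] that by linarith
    have "\<bar>H x - H y\<bar> \<le> C * (2 * e')"
      using le[of x y] that mult_left_mono[OF lt C] by linarith
    also have "\<dots> < (C + 1) * (2 * e')" using e' by (simp add: algebra_simps)
    also have "\<dots> = e" using C by (simp add: e'_def field_simps)
    finally show ?thesis .
  qed
  then show "\<exists>k d. 0 < d \<and> (\<forall>x\<in>space M. \<forall>y\<in>space M. close k d x y \<longrightarrow> \<bar>H x - H y\<bar> < e)"
    using kd(1) kd'(1) by (intro exI[of _ "max k k'"] exI[of _ "min d d'"]) auto
qed

lemma unif_cont_const: "unif_cont (\<lambda>x. c)"
  by (auto simp: unif_cont_def intro: exI[of _ 1])

lemma unif_cont_linear_sum:
  assumes "finite I" "\<And>i. i \<in> I \<Longrightarrow> unif_cont (h i)"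
  shows "unif_cont (\<lambda>x. \<Sum>i\<in>I. a i * h i x)"
  using assms
proof (induction I rule: finite_induct)
  case (insert i I)
  show ?case
  proof (rule unif_cont_combine[where h = "h i" and h' = "\<lambda>x. \<Sum>i\<in>I. a i * h i x" and C = "\<bar>a i\<bar> + 1"])
    fix x y
    have "(\<Sum>j\<in>insert i I. a j * h j x) - (\<Sum>j\<in>insert i I. a j * h j y)
        = a i * (h i x - h i y) + ((\<Sum>i\<in>I. a i * h i x) - (\<Sum>i\<in>I. a i * h i y))" (is "_ = _ + ?r")
      using insert by (simp add: algebra_simps)
    then have "\<bar>(\<Sum>j\<in>insert i I. a j * h j x) - (\<Sum>j\<in>insert i I. a j * h j y)\<bar>
        \<le> \<bar>a i\<bar> * \<bar>h i x - h i y\<bar> + \<bar>?r\<bar>"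
      using abs_triangle_ineq[of "a i * (h i x - h i y)" ?r] by (simp add: abs_mult)
    also have "\<dots> \<le> (\<bar>a i\<bar> + 1) * (\<bar>h i x - h i y\<bar> + \<bar>?r\<bar>)"
      by (simp add: algebra_simps)
    finally show "\<bar>(\<Sum>j\<in>insert i I. a j * h j x) - (\<Sum>j\<in>insert i I. a j * h j y)\<bar>
        \<le> (\<bar>a i\<bar> + 1) * (\<bar>h i x - h i y\<bar> + \<bar>?r\<bar>)" .
  qed (use insert in auto)
qed (simp add: unif_cont_const)

lemma integrable_bounded:
  assumes "h \<in> borel_measurable M" "\<And>x. \<bar>h x\<bar> \<le> C"
  shows "integrable M (h :: _ \<Rightarrow> real)"
proof -
  interpret prob_space M by (rule prob_M)
  show ?thesis using assms by (intro integrable_const_bound[of _ C]) auto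
qed

lemma integrable_abs_indicator_diff:
  assumes "A \<in> sets M" "h \<in> borel_measurable M" "range h \<subseteq> {0..1}"
  shows "integrable M (\<lambda>x. \<bar>indicator A x - h x\<bar> :: real)"
proof (rule integrable_bounded[where C = 1])
  show "\<bar>\<bar>indicator A x - h x\<bar>\<bar> \<le> 1" for x
    using range_unit_intervalD[OF assms(3), of x] by (auto simp: indicator_def)
qed (use assms in measurable)

lemma approximable_compl:
  assumes "approximable A"
  shows "approximable (space M - A)"
  unfolding approximable_def
proof (intro conjI allI impI)
  show "space M - A \<in> sets M" using assms by (auto simp: approximable_def)
  fix e :: real assume "0 < e"
  then obtain h where h: "h \<in> borel_measurable M" "unif_cont h" "range h \<subseteq> {0..1}"
    "(\<integral>x. \<bar>indicator A x - h x\<bar> \<partial>M) < e"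
    using assms unfolding approximable_def by blast
  show "\<exists>h\<in>borel_measurable M. unif_cont h \<and> range h \<subseteq> {0..1} \<and>
      (\<integral>x. \<bar>indicator (space M - A) x - h x\<bar> \<partial>M) < e"
  proof (intro bexI[of _ "\<lambda>x. 1 - h x"] conjI)
    show "unif_cont (\<lambda>x. 1 - h x)"
      by (rule unif_cont_combine[OF h(2) unif_cont_const[of 0], of 1]) auto
    have "(\<integral>x. \<bar>indicator (space M - A) x - (1 - h x)\<bar> \<partial>M) = (\<integral>x. \<bar>indicator A x - h x\<bar> \<partial>M)"
      by (intro Bochner_Integration.integral_cong) (auto simp: indicator_def)
    with h(4) show "(\<integral>x. \<bar>indicator (space M - A) x - (1 - h x)\<bar> \<partial>M) < e" by simp
    show "range (\<lambda>x. 1 - h x) \<subseteq> {0..1}" using h(3) by auto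
  qed (use h in measurable)
qed

lemma approximable_Int:
  assumes A: "approximable A" and B: "approximable B"
  shows "approximable (A \<inter> B)"
  unfolding approximable_def
proof (intro conjI allI impI)
  show AB: "A \<inter> B \<in> sets M" using assms by (auto simp: approximable_def)
  fix e :: real assume "0 < e"
  then have e: "0 < e / 2" by simp
  obtain h where h: "h \<in> borel_measurable M" "unif_cont h" "range h \<subseteq> {0..1}"
    "(\<integral>x. \<bar>indicator A x - h x\<bar> \<partial>M) < e / 2"
    using A e unfolding approximable_def by blast
  obtain h' where h': "h' \<in> borel_measurable M" "unif_cont h'" "range h' \<subseteq> {0..1}"
    "(\<integral>x. \<bar>indicator B x - h' x\<bar> \<partial>M) < e / 2"
    using B e unfolding approximable_def by blast
  have h01: "0 \<le> h x" "h x \<le> 1" and h'01: "0 \<le> h' x" "h' x \<le> 1" for x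
    using range_unit_intervalD[OF h(3)] range_unit_intervalD[OF h'(3)] by auto
  have prod: "\<bar>a * b - c * d\<bar> \<le> \<bar>a - c\<bar> + \<bar>b - d\<bar>"
    if "0 \<le> b" "b \<le> 1" "0 \<le> c" "c \<le> 1" for a b c d :: real
  proof -
    have "a * b - c * d = (a - c) * b + c * (b - d)" by (simp add: algebra_simps)
    then have "\<bar>a * b - c * d\<bar> \<le> \<bar>a - c\<bar> * b + c * \<bar>b - d\<bar>"
      using abs_triangle_ineq[of "(a - c) * b" "c * (b - d)"] that by (simp add: abs_mult)
    also have "\<dots> \<le> \<bar>a - c\<bar> * 1 + 1 * \<bar>b - d\<bar>"
      using that by (intro add_mono mult_left_mono mult_right_mono) auto
    finally show ?thesis by simp
  qed
  have I: "integrable M (\<lambda>x. \<bar>indicator A x - h x\<bar> :: real)" "integrable M (\<lambda>x. \<bar>indicator B x - h' x\<bar> :: real)"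
    using A B h h' by (auto intro!: integrable_abs_indicator_diff simp: approximable_def)
  have "0 \<le> h x * h' x \<and> h x * h' x \<le> 1" for x
    using h01 h'01 by (simp add: mult_le_one)
  then have range: "range (\<lambda>x. h x * h' x) \<subseteq> {0..1}" by (intro image_subsetI) simp
  have meas: "(\<lambda>x. h x * h' x) \<in> borel_measurable M" using h h' by measurable
  show "\<exists>h\<in>borel_measurable M. unif_cont h \<and> range h \<subseteq> {0..1} \<and>
      (\<integral>x. \<bar>indicator (A \<inter> B) x - h x\<bar> \<partial>M) < e"
  proof (intro bexI[OF _ meas] conjI range)
    show "unif_cont (\<lambda>x. h x * h' x)"
      by (rule unif_cont_combine[OF h(2) h'(2), of 1]) (use prod h01 h'01 in auto)
    have "(\<integral>x. \<bar>indicator (A \<inter> B) x - h x * h' x\<bar> \<partial>M)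
        \<le> (\<integral>x. \<bar>indicator A x - h x\<bar> + \<bar>indicator B x - h' x\<bar> \<partial>M)"
    proof (intro integral_mono Bochner_Integration.integrable_add I
        integrable_abs_indicator_diff AB meas range)
      show "\<bar>indicator (A \<inter> B) x - h x * h' x\<bar> \<le> \<bar>indicator A x - h x\<bar> + \<bar>indicator B x - h' x\<bar>" for x
        unfolding indicator_inter_arith using h01 by (intro prod) auto
    qed
    also have "\<dots> < e" using h(4) h'(4) by (simp add: I)
    finally show "(\<integral>x. \<bar>indicator (A \<inter> B) x - h x * h' x\<bar> \<partial>M) < e" .
  qed
qed

lemma approximable_empty: "approximable {}"
  unfolding approximable_def
  by (auto intro!: bexI[of _ "\<lambda>x. 0"] unif_cont_const)

lemma approximable_Un:
  assumes "approximable A" "approximable B"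
  shows "approximable (A \<union> B)"
proof -
  have "A \<subseteq> space M" "B \<subseteq> space M"
    using assms by (auto simp: approximable_def dest: sets.sets_into_space)
  then have "A \<union> B = space M - ((space M - A) \<inter> (space M - B))" by blast
  with assms show ?thesis by (metis approximable_compl approximable_Int)
qed

lemma approximable_limit:
  assumes A: "A \<in> sets M"
    and h: "\<And>n. h n \<in> borel_measurable M" "\<And>n. unif_cont (h n)" "\<And>n. range (h n) \<subseteq> {0..1}"
    and lim: "\<And>x. x \<in> space M \<Longrightarrow> (\<lambda>n. h n x) \<longlonglongrightarrow> indicator A x"
  shows "approximable A"
  unfolding approximable_def
proof (intro conjI allI impI A)
  fix e :: real assume e: "0 < e"
  have "(\<lambda>n. \<integral>x. \<bar>indicator A x - h n x\<bar> \<partial>M) \<longlonglongrightarrow> (\<integral>x. 0 \<partial>M)"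
  proof (rule integral_dominated_convergence[where w = "\<lambda>x. 1"])
    show "AE x in M. (\<lambda>n. \<bar>indicator A x - h n x\<bar>) \<longlonglongrightarrow> 0"
    proof (rule AE_I2)
      fix x assume "x \<in> space M"
      from tendsto_diff[OF tendsto_const lim[OF this], of "indicator A x"]
      show "(\<lambda>n. \<bar>indicator A x - h n x\<bar>) \<longlonglongrightarrow> 0" by (simp add: tendsto_rabs_zero_iff)
    qed
    have "0 \<le> h n x \<and> h n x \<le> 1" for n x
      using range_unit_intervalD[OF h(3)] by auto
    then show "AE x in M. norm \<bar>indicator A x - h n x\<bar> \<le> 1" for n
      by (intro AE_I2) (auto simp: indicator_def)
    show "integrable M (\<lambda>x. 1 :: real)" by (rule integrable_bounded[of _ 1]) auto
  qed (use A h(1) in measurable)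
  then have "(\<lambda>n. \<integral>x. \<bar>indicator A x - h n x\<bar> \<partial>M) \<longlonglongrightarrow> 0" by simp
  then have "\<forall>\<^sub>F n in sequentially. (\<integral>x. \<bar>indicator A x - h n x\<bar> \<partial>M) < e"
    using e by (rule order_tendstoD)
  then obtain n where "(\<integral>x. \<bar>indicator A x - h n x\<bar> \<partial>M) < e"
    by (auto simp: eventually_sequentially)
  then show "\<exists>h\<in>borel_measurable M. unif_cont h \<and> range h \<subseteq> {0..1} \<and>
      (\<integral>x. \<bar>indicator A x - h x\<bar> \<partial>M) < e"
    using h by blast
qed

text \<open>Continuity of the measure leaves a finite union with missing mass below
  \<open>e / 2\<close>; the other half of \<open>e\<close> is spent on approximating that
  union.\<close>

lemma approximable_UN:
  fixes A :: "nat \<Rightarrow> _"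
  assumes A: "\<And>i. approximable (A i)"
  shows "approximable (\<Union>i. A i)"
proof -
  interpret prob_space M by (rule prob_M)
  let ?B = "\<lambda>n. \<Union>i<n. A i" and ?A = "\<Union>i. A i"
  have B: "approximable (?B n)" for n
    by (induction n) (auto simp: lessThan_Suc approximable_empty intro!: approximable_Un A)
  have meas: "?B n \<in> sets M" "?A \<in> sets M" for n
    using A B[of n] by (auto simp: approximable_def)
  have "?A \<in> sets M \<and> (\<forall>e>0. \<exists>h\<in>borel_measurable M. unif_cont h \<and> range h \<subseteq> {0..1} \<and>
      (\<integral>x. \<bar>indicator ?A x - h x\<bar> \<partial>M) < e)"
  proof (intro conjI allI impI meas)
    fix e :: real assume e: "0 < e"
    have "(\<lambda>n. measure M (?B n)) \<longlonglongrightarrow> measure M (\<Union>n. ?B n)"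
      using meas by (intro finite_Lim_measure_incseq) (fastforce simp: incseq_def)+
    also have "(\<Union>n. ?B n) = ?A" by auto
    finally have "\<forall>\<^sub>F n in sequentially. measure M ?A - e / 2 < measure M (?B n)"
      using e by (intro order_tendstoD) auto
    then obtain n where n: "measure M ?A - e / 2 < measure M (?B n)"
      by (auto simp: eventually_sequentially)
    obtain h where h: "h \<in> borel_measurable M" "unif_cont h" "range h \<subseteq> {0..1}"
      "(\<integral>x. \<bar>indicator (?B n) x - h x\<bar> \<partial>M) < e / 2"
      using B[of n] half_gt_zero[OF e] unfolding approximable_def by blast
    have I: "integrable M (indicator (?A - ?B n) :: _ \<Rightarrow> real)"
      using meas by (intro integrable_bounded[of _ 1]) (auto simp: indicator_def)
    have "(\<integral>x. \<bar>indicator ?A x - h x\<bar> \<partial>M)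
        \<le> (\<integral>x. indicator (?A - ?B n) x + \<bar>indicator (?B n) x - h x\<bar> \<partial>M)"
    proof (intro integral_mono Bochner_Integration.integrable_add I integrable_abs_indicator_diff meas h)
      show "\<bar>indicator ?A x - h x\<bar> \<le> indicator (?A - ?B n) x + \<bar>indicator (?B n) x - h x\<bar>" for x
        by (auto simp: indicator_def)
    qed
    also have "\<dots> = measure M (?A - ?B n) + (\<integral>x. \<bar>indicator (?B n) x - h x\<bar> \<partial>M)"
      using meas h I by (subst Bochner_Integration.integral_add)
        (auto intro!: integrable_abs_indicator_diff simp: Int_absorb2 sets.sets_into_space)
    also have "measure M (?A - ?B n) = measure M ?A - measure M (?B n)"
      using meas by (intro finite_measure_Diff) auto
    finally have "(\<integral>x. \<bar>indicator ?A x - h x\<bar> \<partial>M) < e" using n h(4) by linarith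
    with h show "\<exists>h\<in>borel_measurable M. unif_cont h \<and> range h \<subseteq> {0..1} \<and>
        (\<integral>x. \<bar>indicator ?A x - h x\<bar> \<partial>M) < e" by blast
  qed
  then show ?thesis unfolding approximable_def .
qed

lemma approximable_cylinder: "approximable {x \<in> space M. fst x i = a}"
proof (rule approximable_limit[where h = "\<lambda>_ x. if fst x i = a then 1 else 0"])
  show "{x \<in> space M. fst x i = a} \<in> sets M" by measurable
  show "(\<lambda>x. if fst x i = a then 1 else 0 :: real) \<in> borel_measurable M" by measurable
  show "unif_cont (\<lambda>x. if fst x i = a then 1 else 0)"
    by (auto simp: unif_cont_def close_def intro!: exI[of _ "Suc i"] exI[of _ "1::real"])
qed (auto simp: indicator_def)

text \<open>The functions \<open>?h n\<close> equal 1 on \<open>C\<close>, are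
  \<open>n\<close>-Lipschitz in the fibre coordinate, and are eventually 0 at each point off
  \<open>C\<close>.\<close>

lemma approximable_closed:
  fixes C :: "'z set"
  assumes C: "closed C"
  shows "approximable {x \<in> space M. snd x \<in> C}"
\<comment> \<open>The distance to the empty set is 0 by convention, so the functions below would be
  constantly 1 in that case.\<close>
proof (cases "C = {}")
  case False
  let ?h = "\<lambda>n x. max 0 (1 - real n * infdist (snd x) C)"
  have meas: "(\<lambda>x. infdist (snd x) C) \<in> borel_measurable M"
    using measurable_compose[OF snd_borel_measurable
        borel_measurable_continuous_onI[OF continuous_on_infdist[OF continuous_on_id]]] by simp
  have base: "unif_cont (\<lambda>x. infdist (snd x) C)"
    unfolding unif_cont_def
  proof (intro allI impI)
    fix e :: real assume "0 < e"
    then show "\<exists>k d. 0 < d \<and> (\<forall>x\<in>space M. \<forall>y\<in>space M. close k d x y \<longrightarrow>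
        \<bar>infdist (snd x) C - infdist (snd y) C\<bar> < e)"
      by (intro exI[of _ 0] exI[of _ e])
         (auto simp: close_def intro: le_less_trans[OF infdist_triangle_abs])
  qed
  show ?thesis
  proof (rule approximable_limit[where h = ?h])
    show "{x \<in> space M. snd x \<in> C} \<in> sets M"
      using measurable_sets[OF snd_borel_measurable borel_closed[OF C]]
      by (simp add: vimage_def Int_def conj_commute)
    show "?h n \<in> borel_measurable M" for n using meas by measurable
    show "unif_cont (?h n)" for n
    proof (rule unif_cont_combine[OF base unif_cont_const[of 0], of "real n"])
      fix x y
      have "\<bar>?h n x - ?h n y\<bar> \<le> \<bar>real n * (infdist (snd x) C - infdist (snd y) C)\<bar>"
        unfolding right_diff_distrib by (auto simp: max_def abs_if)
      then show "\<bar>?h n x - ?h n y\<bar> \<le> real n * (\<bar>infdist (snd x) C - infdist (snd y) C\<bar> + \<bar>0 - 0\<bar>)"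
        by (simp add: abs_mult)
    qed simp
    show "range (?h n) \<subseteq> {0..1}" for n by (auto simp: infdist_nonneg)
    fix x assume x: "x \<in> space M"
    show "(\<lambda>n. ?h n x) \<longlonglongrightarrow> indicator {x \<in> space M. snd x \<in> C} x"
    proof (cases "snd x \<in> C")
      case True
      then show ?thesis using x by simp
    next
      case notin: False
      then have pos: "0 < infdist (snd x) C"
        using infdist_pos_not_in_closed[OF C False] by auto
      obtain n0 :: nat where n0: "1 / infdist (snd x) C < real n0" using reals_Archimedean2 by blast
      have "\<forall>\<^sub>F n in sequentially. ?h n x = 0"
        using eventually_ge_at_top[of n0]
      proof eventually_elim
        fix n assume "n0 \<le> n"
        then have "1 / infdist (snd x) C < real n" using n0 by linarith
        then show "?h n x = 0" using pos by (simp add: field_simps max_def)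
      qed
      then show ?thesis using notin by (simp add: tendsto_eventually)
    qed
  qed
qed (simp add: approximable_empty)

text \<open>Approximable sets form a sigma-algebra. Both coordinates are measurable for it, hence so
  is the identity into \<open>M\<close>, and this says that it contains every set of
  \<open>M\<close>.\<close>

lemma approximable_sets:
  assumes "A \<in> sets M"
  shows "approximable A"
proof -
  let ?L = "{A. approximable A}"
  have L_sub: "?L \<subseteq> Pow (space M)"
    by (auto simp: approximable_def dest: sets.sets_into_space)
  have sig: "sigma_algebra (space M) ?L"
    unfolding sigma_algebra_iff2
  proof (intro conjI ballI allI impI L_sub)
    show "{} \<in> ?L" "\<And>A. A \<in> ?L \<Longrightarrow> space M - A \<in> ?L"
      by (auto simp: approximable_empty intro: approximable_compl)
    fix A :: "nat \<Rightarrow> _" assume "range A \<subseteq> ?L"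
    then have "approximable (A i)" for i by blast
    then show "(\<Union>i. A i) \<in> ?L" using approximable_UN[of A] by simp
  qed
  define N where "N = sigma (space M) ?L"
  have N: "space N = space M" "sets N = ?L"
    unfolding N_def using L_sub sigma_algebra.sets_measure_of_eq[OF sig] by (auto simp: space_measure_of)
  have "(\<lambda>x. fst x) \<in> N \<rightarrow>\<^sub>M std_space p"
  proof (rule measurable_into_std)
    show "(\<lambda>x. fst x i) \<in> N \<rightarrow>\<^sub>M count_space UNIV" for i
      using approximable_cylinder
      by (auto simp: measurable_count_space_eq2_countable N vimage_def Int_def conj_commute)
  qed (simp add: N fst_space)
  moreover have "(\<lambda>x. snd x) \<in> N \<rightarrow>\<^sub>M m"
  proof -
    have "(\<lambda>x. snd x) \<in> N \<rightarrow>\<^sub>M borel"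
      unfolding borel_eq_closed
      using approximable_closed
      by (intro measurable_measure_of) (auto simp: N vimage_def Int_def conj_commute)
    then show ?thesis by (simp add: measurable_cong_sets[OF refl sets_m])
  qed
  ultimately have "(\<lambda>x. (fst x, snd x)) \<in> N \<rightarrow>\<^sub>M M"
    unfolding M_def by (rule measurable_Pair)
  from measurable_sets[OF this assms] have "A \<inter> space M \<in> ?L" by (simp add: N)
  then show ?thesis using sets.sets_into_space[OF assms] by (simp add: Int_absorb2)
qed

lemma simple_function_approx:
  fixes P :: "_ \<Rightarrow> nat"
  assumes P: "simple_function M P" and \<delta>: "0 < \<delta>"
  shows "\<exists>h\<in>borel_measurable M. unif_cont h \<and> integrable M (\<lambda>x. \<bar>real (P x) - h x\<bar>) \<and>
    (\<integral>x. \<bar>real (P x) - h x\<bar> \<partial>M) < \<delta>"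
proof -
  interpret prob_space M by (rule prob_M)
  let ?V = "P ` space M"
  let ?A = "\<lambda>a. P -` {a} \<inter> space M"
  have fin: "finite ?V" and A: "?A a \<in> sets M" for a using P by (auto dest: simple_functionD)
  \<comment> \<open>The total weight of the errors is \<open>C - 1\<close>; the extra 1 makes
    \<open>C\<close> positive and the final inequality strict.\<close>
  define C where "C = (\<Sum>a\<in>?V. real a) + 1"
  have C: "0 < C" unfolding C_def by (intro add_nonneg_pos sum_nonneg) auto
  have "\<exists>h \<in> borel_measurable M. unif_cont h \<and> range h \<subseteq> {0..1} \<and>
      (\<integral>x. \<bar>indicator (?A a) x - h x\<bar> \<partial>M) < \<delta> / C" for a
    using approximable_sets[OF A[of a]] divide_pos_pos[OF \<delta> C] unfolding approximable_def by blast
  then have "\<forall>a. \<exists>h. h \<in> borel_measurable M \<and> unif_cont h \<and> range h \<subseteq> {0..1} \<and>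
      (\<integral>x. \<bar>indicator (?A a) x - h x\<bar> \<partial>M) < \<delta> / C" by blast
  from choice[OF this] obtain h where h':
    "\<forall>a. h a \<in> borel_measurable M \<and> unif_cont (h a) \<and> range (h a) \<subseteq> {0..1} \<and>
      (\<integral>x. \<bar>indicator (?A a) x - h a x\<bar> \<partial>M) < \<delta> / C" ..
  note h = h'[rule_format, THEN conjunct1] h'[rule_format, THEN conjunct2, THEN conjunct1]
    h'[rule_format, THEN conjunct2, THEN conjunct2, THEN conjunct1]
    h'[rule_format, THEN conjunct2, THEN conjunct2, THEN conjunct2]
  define H where "H x = (\<Sum>a\<in>?V. real a * h a x)" for x
  have I: "integrable M (\<lambda>x. \<bar>indicator (?A a) x - h a x\<bar> :: real)" for a
    using A h by (intro integrable_abs_indicator_diff)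
  have H: "H \<in> borel_measurable M" unfolding H_def using h(1) by measurable
  have uc: "unif_cont H" unfolding H_def[abs_def] using fin h(2) by (intro unif_cont_linear_sum)
  have Pm: "(\<lambda>x. real (P x)) \<in> borel_measurable M"
    by (rule borel_measurable_simple_function[OF simple_function_compose1[OF P]])
  have bound: "\<bar>real (P x) - H x\<bar> \<le> (\<Sum>a\<in>?V. real a * \<bar>indicator (?A a) x - h a x\<bar>)"
    if x: "x \<in> space M" for x
  proof -
    have "real (P x) = (\<Sum>a\<in>?V. real a * indicator (?A a) x)"
    proof -
      have "(\<Sum>a\<in>?V. real a * indicator (?A a) x) = (\<Sum>a\<in>{P x}. real a * indicator (?A a) x)"
        using fin x by (intro sum.mono_neutral_right) (auto simp: indicator_def)
      then show ?thesis using x by simp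
    qed
    then have "real (P x) - H x = (\<Sum>a\<in>?V. real a * (indicator (?A a) x - h a x))"
      by (simp add: H_def sum_subtractf algebra_simps)
    then have "\<bar>real (P x) - H x\<bar> \<le> (\<Sum>a\<in>?V. \<bar>real a * (indicator (?A a) x - h a x)\<bar>)"
      using sum_abs by simp
    then show ?thesis by (simp add: abs_mult)
  qed
  have IS: "integrable M (\<lambda>x. \<Sum>a\<in>?V. real a * \<bar>indicator (?A a) x - h a x\<bar>)"
    using I by (intro Bochner_Integration.integrable_sum integrable_mult_right) auto
  have IP: "integrable M (\<lambda>x. \<bar>real (P x) - H x\<bar>)"
  proof (rule Bochner_Integration.integrable_bound[OF IS])
    show "(\<lambda>x. \<bar>real (P x) - H x\<bar>) \<in> borel_measurable M" using Pm H by measurable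
    show "AE x in M. norm \<bar>real (P x) - H x\<bar>
        \<le> norm (\<Sum>a\<in>?V. real a * \<bar>indicator (?A a) x - h a x\<bar>)"
      using bound by (intro AE_I2) (auto intro: order_trans[OF _ abs_ge_self])
  qed
  have "(\<integral>x. \<bar>real (P x) - H x\<bar> \<partial>M) \<le> (\<integral>x. (\<Sum>a\<in>?V. real a * \<bar>indicator (?A a) x - h a x\<bar>) \<partial>M)"
    using bound by (intro integral_mono IP IS)
  also have "\<dots> = (\<Sum>a\<in>?V. real a * (\<integral>x. \<bar>indicator (?A a) x - h a x\<bar> \<partial>M))"
    using I by (subst Bochner_Integration.integral_sum) auto
  also have "\<dots> \<le> (\<Sum>a\<in>?V. real a * (\<delta> / C))"
    by (intro sum_mono mult_left_mono less_imp_le[OF h(4)]) simp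
  also have "\<dots> = (\<Sum>a\<in>?V. real a) * (\<delta> / C)" by (rule sum_distrib_right[symmetric])
  also have "\<dots> = (C - 1) * (\<delta> / C)" by (simp only: C_def) simp
  also have "\<dots> < \<delta>" using C \<delta> by (simp add: field_simps)
  finally show ?thesis using H uc IP by blast
qed

section \<open>Upper and lower bound for the entropy\<close>

lemma ex_cell_index:
  assumes d: "0 < d"
  shows "\<exists>(q :: 'z \<Rightarrow> nat) r. q \<in> m \<rightarrow>\<^sub>M count_space UNIV \<and> range q \<subseteq> {..<r} \<and>
    (\<forall>z w. q z = q w \<longrightarrow> dist z w < d)"
proof -
  obtain Q :: "'z set" where Q: "finite Q" "\<forall>z. \<exists>q\<in>Q. dist z q < d / 2"
    using finite_net[OF half_gt_zero[OF d]] by blast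
  obtain ws where ws: "set ws = Q" using finite_list[OF Q(1)] by blast
  \<comment> \<open>The index of the first net point within \<open>d / 2\<close>: taking the least
    index makes overlapping balls into a measurable partition.\<close>
  define q where "q z = (LEAST i. i < length ws \<and> dist z (ws ! i) < d / 2)" for z
  have q: "q z < length ws \<and> dist z (ws ! q z) < d / 2" for z
  proof -
    obtain w where "w \<in> set ws" "dist z w < d / 2" using Q(2) ws by blast
    then have "\<exists>i. i < length ws \<and> dist z (ws ! i) < d / 2" by (auto simp: in_set_conv_nth)
    then show ?thesis unfolding q_def by (rule LeastI_ex)
  qed
  have "q \<in> borel \<rightarrow>\<^sub>M count_space UNIV"
    unfolding q_def[abs_def]
  proof (intro measurable_Least pred_intros_logic)
    fix i
    have "(\<lambda>z. dist z (ws ! i)) \<in> borel_measurable borel"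
      by (intro borel_measurable_continuous_onI continuous_intros)
    then show "Measurable.pred borel (\<lambda>z. dist z (ws ! i) < d / 2)" by measurable
  qed simp
  then have "q \<in> m \<rightarrow>\<^sub>M count_space UNIV" by (simp add: measurable_cong_sets[OF sets_m refl])
  moreover have "dist z w < d" if "q z = q w" for z w
  proof -
    have "dist z w \<le> dist z (ws ! q z) + dist w (ws ! q z)" by (rule dist_triangle2)
    also have "\<dots> < d / 2 + d / 2" using q[of z] q[of w] that by (intro add_strict_mono) auto
    finally show ?thesis by simp
  qed
  moreover have "range q \<subseteq> {..<length ws}" using q by auto
  ultimately show ?thesis by blast
qed

text \<open>The first \<open>n + k\<close> symbols of \<open>x\<close> and the cell of the fibre coordinate of \<open>T\<^sup>n x\<close> determine
  the orbit segment of length \<open>n\<close> up to a small error, because the inverse branches leading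
  back from \<open>T\<^sup>n x\<close> do not spread close points apart.\<close>

lemma orbit_close:
  assumes x: "x \<in> space M" "y \<in> space M" and j: "j \<le> n"
    and eq: "\<And>i. i < n + k \<Longrightarrow> fst x i = fst y i"
    and d: "dist (snd ((T ^^ n) x)) (snd ((T ^^ n) y)) < d"
  shows "close k (d + tail (Suc k)) ((T ^^ j) x) ((T ^^ j) y)"
proof -
  have "close k d ((T ^^ n) x) ((T ^^ n) y)"
    using eq d by (auto simp: close_def fst_Tn)
  moreover have Tn: "(T ^^ n) x = (T ^^ (n - j)) ((T ^^ j) x)" for x
    using j by (simp flip: funpow_add[THEN fun_cong, simplified])
  moreover let ?v = "rev (map (fst ((T ^^ j) x)) [0..<n - j])"
  have v: "?v = rev (map (fst ((T ^^ j) y)) [0..<n - j])"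
    using eq by (auto simp: fst_Tn)
  moreover have "?v \<in> words p"
    using Tn_space[OF x(1), of j] by (auto simp: words_def space_M)
  ultimately have "close (k + length ?v) (d + tail (Suc k))
      (branch S ?v ((T ^^ (n - j)) ((T ^^ j) x))) (branch S ?v ((T ^^ (n - j)) ((T ^^ j) y)))"
    using x by (intro close_branch Tn_space) auto
  moreover have "branch S ?v ((T ^^ (n - j)) ((T ^^ j) x)) = (T ^^ j) x"
    by (intro branch_S_Tn Tn_space x)
  moreover have "branch S ?v ((T ^^ (n - j)) ((T ^^ j) y)) = (T ^^ j) y"
    unfolding v by (intro branch_S_Tn Tn_space x)
  ultimately have "close (k + length ?v) (d + tail (Suc k)) ((T ^^ j) x) ((T ^^ j) y)" by simp
  then show ?thesis by (rule close_mono) auto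
qed

text \<open>The itinerary is recovered from the code \<open>I x\<close>, which takes at most
  \<open>p ^ (n + k) * r\<close> values, and from corrections \<open>E j\<close>. The code predicts
  the \<open>j\<close>-th label up to an event which, by Markov's inequality, has probability at
  most \<open>4 * \<delta>\<close>. So each correction has small entropy, and the code costs
  \<open>ln p\<close> per step in the limit.\<close>

lemma entropy_rate_le_approx:
  fixes P :: "_ \<Rightarrow> nat"
  assumes P: "simple_function M P" and \<delta>: "0 < \<delta>" and s: "0 < s" "s < 1"
  shows "entropy_rate M T P
    \<le> ln p + (4 * \<delta> * (- ln s) + real (Suc (card (P ` space M))) * s)"
proof -
  interpret prob_space M by (rule prob_M)
  note mp = measure_preserving_map_funpow[OF T_measure_preserving]
  note PT = partition_entropy_measure_preserving(1)[OF P mp]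
  obtain h where h: "h \<in> borel_measurable M" "unif_cont h"
    "integrable M (\<lambda>x. \<bar>real (P x) - h x\<bar>)" "(\<integral>x. \<bar>real (P x) - h x\<bar> \<partial>M) < \<delta>"
    using simple_function_approx[OF P \<delta>] by blast
  have "\<exists>k d. 0 < d \<and> (\<forall>x\<in>space M. \<forall>y\<in>space M. close k d x y \<longrightarrow> \<bar>h x - h y\<bar> < 1 / 4)"
    using h(2) unfolding unif_cont_def by (rule allE[of _ "1 / 4"]) simp
  then obtain k0 d0 where kd: "0 < d0"
    "\<And>x y. x \<in> space M \<Longrightarrow> y \<in> space M \<Longrightarrow> close k0 d0 x y \<Longrightarrow> \<bar>h x - h y\<bar> < 1 / 4"
    by blast
  have "\<forall>\<^sub>F k in sequentially. tail k < d0 / 2"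
    using tail_tendsto_0 half_gt_zero[OF kd(1)] by (rule order_tendstoD)
  then obtain k1 where k1: "\<And>k. k \<ge> k1 \<Longrightarrow> tail k < d0 / 2" by (auto simp: eventually_sequentially)
  define k where "k = max k0 k1"
  have k: "k0 \<le> k" "tail (Suc k) < d0 / 2" using k1 by (auto simp: k_def)
  obtain q :: "'z \<Rightarrow> nat" and r where q: "q \<in> m \<rightarrow>\<^sub>M count_space UNIV" "range q \<subseteq> {..<r}"
    "\<And>z w. q z = q w \<Longrightarrow> dist z w < d0 / 2"
    using ex_cell_index[OF half_gt_zero[OF kd(1)]] by blast
  have r: "0 < r" using q(2) by (cases r) auto
  define err where "err = 4 * \<delta> * (- ln s) + real (Suc (card (P ` space M))) * s"
  have bad: "measure M {x \<in> space M. 1 / 4 \<le> \<bar>real (P x) - h x\<bar>} \<le> 4 * \<delta>"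
  proof -
    have "measure M {x \<in> space M. 1 / 4 \<le> \<bar>real (P x) - h x\<bar>}
        \<le> (\<integral>x. \<bar>real (P x) - h x\<bar> \<partial>M) / (1 / 4)"
      by (intro integral_Markov_inequality_measure[where A = "{}"] h(3)) auto
    then show ?thesis using h(4) by simp
  qed
  have main: "partition_entropy M (itinerary T P n) \<le> real (n + k) * ln p + ln r + real n * err" for n
  proof -
    define I where "I x = (map (fst x) [0..<n + k], q (snd ((T ^^ n) x)))" for x
    define rep where "rep i = (SOME x. x \<in> space M \<and> I x = i)" for i
    \<comment> \<open>The predicted label: the approximating function, rounded at the
      \<open>j\<close>-th image of one chosen representative of the code class.\<close>
    define ref where "ref j i = nat (round (h ((T ^^ j) (rep i))))" for j i
    \<comment> \<open>The successor leaves 0 free to mean that the prediction is correct.\<close>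
    define E where "E j x = (if P ((T ^^ j) x) = ref j (I x) then 0 else Suc (P ((T ^^ j) x)))" for j x
    have rep: "rep (I x) \<in> space M" "I (rep (I x)) = I x" if "x \<in> space M" for x
      using someI[of "\<lambda>y. y \<in> space M \<and> I y = I x" x] that by (auto simp: rep_def)
    have I_range: "I ` space M \<subseteq> level p (n + k) \<times> {..<r}"
      using q(2) by (auto simp: I_def level_eq space_M)
    have "(\<lambda>x. q (snd ((T ^^ n) x))) \<in> M \<rightarrow>\<^sub>M count_space UNIV"
      using mp[of n] by (intro measurable_compose[OF measurable_compose[OF _ snd_measurable_M] q(1)])
        (auto simp: measure_preserving_map_def)
    moreover have "(\<lambda>x. map (fst x) [0..<n + k]) \<in> M \<rightarrow>\<^sub>M count_space UNIV" by measurable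
    ultimately have SI: "simple_function M I"
      unfolding I_def[abs_def]
      using finite_subset[OF I_range]
      by (intro simple_function_Pair simple_function_countable)
         (auto simp: I_def image_def intro!: finite_subset[OF _ finite_imageI[of "I ` space M" fst]]
            finite_subset[OF _ finite_imageI[of "I ` space M" snd]])
    have SE: "simple_function M (E j)" for j
    proof -
      have "simple_function M (\<lambda>x. (P ((T ^^ j) x), I x))" by (intro simple_function_Pair PT SI)
      from simple_function_compose1[OF this, of "\<lambda>(a, i). if a = ref j i then 0 else Suc a"]
      show ?thesis by (simp add: E_def[abs_def])
    qed
    have "partition_entropy M I \<le> ln (real (card (I ` space M)))"
      by (rule partition_entropy_le_ln_card[OF SI])
    also have "\<dots> \<le> ln (real (p ^ (n + k) * r))"
    proof (rule ln_mono)
      have "card (I ` space M) \<le> card (level p (n + k) \<times> {..<r})"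
        by (intro card_mono I_range) simp
      then show "real (card (I ` space M)) \<le> real (p ^ (n + k) * r)"
        by (simp only: card_level card_cartesian_product card_lessThan of_nat_le_iff)
      show "0 < real (card (I ` space M))"
        using not_empty finite_subset[OF I_range] by (simp add: card_gt_0_iff)
    qed
    also have "\<dots> = real (n + k) * ln p + ln r"
      using r p_pos by (simp add: ln_mult ln_realpow)
    finally have HI: "partition_entropy M I \<le> real (n + k) * ln p + ln r" .
    have HE: "partition_entropy M (E j) \<le> err" if j: "j \<in> {0..<n}" for j
    proof -
      have "card (E j ` space M) \<le> card (insert 0 (Suc ` P ` space M))"
      proof (rule card_mono)
        show "finite (insert 0 (Suc ` P ` space M))" using P by (auto dest: simple_functionD)
        show "E j ` space M \<subseteq> insert 0 (Suc ` P ` space M)"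
          by (auto simp: E_def intro!: imageI Tn_space)
      qed
      also have "\<dots> \<le> Suc (card (Suc ` P ` space M))" by (rule card_insert_le_m1) simp_all
      also have "card (Suc ` P ` space M) = card (P ` space M)" by (intro card_image) simp
      finally have card: "card (E j ` space M) \<le> Suc (card (P ` space M))" by simp
      have sub: "{x \<in> space M. E j x \<noteq> 0}
          \<subseteq> (T ^^ j) -` {x \<in> space M. 1 / 4 \<le> \<bar>real (P x) - h x\<bar>} \<inter> space M"
      proof
        fix x assume "x \<in> {x \<in> space M. E j x \<noteq> 0}"
        then have x: "x \<in> space M" "E j x \<noteq> 0" by auto
        let ?y = "rep (I x)"
        note y = rep[OF x(1)]
        have "\<not> \<bar>real (P ((T ^^ j) x)) - h ((T ^^ j) x)\<bar> < 1 / 4"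
        proof
          assume lt: "\<bar>real (P ((T ^^ j) x)) - h ((T ^^ j) x)\<bar> < 1 / 4"
          have eq: "map (fst x) [0..<n + k] = map (fst ?y) [0..<n + k]"
            "q (snd ((T ^^ n) x)) = q (snd ((T ^^ n) ?y))"
            using y(2) by (auto simp: I_def)
          have "fst x i = fst ?y i" if "i < n + k" for i
            using arg_cong[OF eq(1), of "\<lambda>l. l ! i"] that by simp
          then have "close k (d0 / 2 + tail (Suc k)) ((T ^^ j) x) ((T ^^ j) ?y)"
            using j q(3)[OF eq(2)] by (intro orbit_close[where n = n] x y) auto
          then have "close k0 d0 ((T ^^ j) x) ((T ^^ j) ?y)"
            by (rule close_mono) (use k in auto)
          then have "\<bar>h ((T ^^ j) x) - h ((T ^^ j) ?y)\<bar> < 1 / 4"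
            by (intro kd(2) Tn_space x y)
          \<comment> \<open>One quarter from the approximation at the \<open>j\<close>-th image of
            \<open>x\<close> and one quarter from uniform continuity give less than one half, so
            rounding returns the label.\<close>
          with lt have "\<bar>h ((T ^^ j) ?y) - of_int (int (P ((T ^^ j) x)))\<bar> < 1 / 2"
            unfolding of_int_of_nat_eq by linarith
          then have "round (h ((T ^^ j) ?y)) = int (P ((T ^^ j) x))" by (rule round_unique')
          then have "E j x = 0" by (simp add: E_def ref_def)
          with x(2) show False ..
        qed
        then show "x \<in> (T ^^ j) -` {x \<in> space M. 1 / 4 \<le> \<bar>real (P x) - h x\<bar>} \<inter> space M"
          using x Tn_space[OF x(1), of j] by (simp add: not_less)
      qed
      have meas: "{x \<in> space M. 1 / 4 \<le> \<bar>real (P x) - h x\<bar>} \<in> sets M"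
        using borel_measurable_integrable[OF h(3)] by measurable
      have "prob {x \<in> space M. E j x \<noteq> 0}
          \<le> prob ((T ^^ j) -` {x \<in> space M. 1 / 4 \<le> \<bar>real (P x) - h x\<bar>} \<inter> space M)"
        using mp[of j] meas by (intro finite_measure_mono[OF sub])
          (auto simp: measure_preserving_map_def intro: measurable_sets)
      also have "\<dots> = measure (distr M M (T ^^ j)) {x \<in> space M. 1 / 4 \<le> \<bar>real (P x) - h x\<bar>}"
        using mp[of j] meas by (intro measure_distr[symmetric]) (auto simp: measure_preserving_map_def)
      also have "\<dots> \<le> 4 * \<delta>" using mp[of j] bad by (simp add: measure_preserving_map_def)
      finally have prob: "prob {x \<in> space M. E j x \<noteq> 0} \<le> 4 * \<delta>" .
      have "partition_entropy M (E j)
          \<le> prob {x \<in> space M. E j x \<noteq> 0} * (- ln s) + real (card (E j ` space M)) * s"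
        by (rule partition_entropy_le_of_mostly_zero[OF SE s])
      also have "\<dots> \<le> err"
        unfolding err_def using prob card s by (intro add_mono mult_right_mono) auto
      finally show ?thesis .
    qed
    let ?Es = "\<lambda>x. map (\<lambda>j. E j x) [0..<n]"
    have SEs: "simple_function M ?Es" by (intro simple_function_map SE)
    have "partition_entropy M (itinerary T P n) \<le> partition_entropy M (\<lambda>x. (I x, ?Es x))"
    proof (rule partition_entropy_le_of_factor)
      show "simple_function M (\<lambda>x. (I x, ?Es x))" by (intro simple_function_Pair SI SEs)
      show "itinerary T P n x = (\<lambda>(i, es). map (\<lambda>j. if es ! j = 0 then ref j i else es ! j - 1) [0..<n])
          (I x, ?Es x)" for x
        by (auto simp: itinerary_def E_def)
    qed
    also have "\<dots> \<le> partition_entropy M I + partition_entropy M ?Es"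
      by (intro partition_entropy_pair_le SI SEs)
    also have "partition_entropy M ?Es \<le> (\<Sum>j\<leftarrow>[0..<n]. partition_entropy M (E j))"
      by (intro partition_entropy_map_le SE)
    also have "\<dots> = (\<Sum>j\<in>{0..<n}. partition_entropy M (E j))"
      by (simp add: interv_sum_list_conv_sum_set_nat)
    also have "\<dots> \<le> (\<Sum>j\<in>{0..<n}. err)" by (intro sum_mono HE)
    finally show ?thesis using HI by simp
  qed
  \<comment> \<open>Neither \<open>k\<close> nor \<open>r\<close> depends on \<open>n\<close>, so
    the overhead of the code vanishes in the rate.\<close>
  have lim: "(\<lambda>n. (ln p + err) + (real k * ln p + ln r) / real n) \<longlonglongrightarrow> (ln p + err) + 0"
    by (intro tendsto_add tendsto_const lim_const_over_n)
  have "entropy_rate M T P \<le> (ln p + err) + 0"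
  proof (rule LIMSEQ_le[OF entropy_rate_limit[OF P T_measure_preserving] lim], intro exI allI impI)
    fix n :: nat assume n: "1 \<le> n"
    have "partition_entropy M (itinerary T P n) / real n
        \<le> (real (n + k) * ln p + ln r + real n * err) / real n"
      using main n by (intro divide_right_mono) auto
    also have "\<dots> = (ln p + err) + (real k * ln p + ln r) / real n"
      using n by (simp add: field_simps)
    finally show "partition_entropy M (itinerary T P n) / real n
        \<le> (ln p + err) + (real k * ln p + ln r) / real n" .
  qed
  then show ?thesis by (simp add: err_def)
qed

lemma entropy_rate_le:
  fixes P :: "_ \<Rightarrow> nat"
  assumes P: "simple_function M P"
  shows "entropy_rate M T P \<le> ln p"
proof (rule field_le_epsilon)
  fix e :: real assume e: "0 < e"
  define C where "C = real (Suc (card (P ` space M)))"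
  define s where "s = min (1 / 2) (e / (2 * C))"
  have C: "0 < C" by (simp add: C_def)
  have s: "0 < s" "s < 1" using e C by (auto simp: s_def)
  have "C * s \<le> C * (e / (2 * C))" using C by (intro mult_left_mono) (auto simp: s_def)
  then have Cs: "C * s \<le> e / 2" using C by simp
  have ln: "0 < - ln s" using s by simp
  \<comment> \<open>The order matters: \<open>s\<close> is fixed from the number of labels alone,
    and \<delta> then compensates the large factor \<open>- ln s\<close>. Each of the two error
    terms receives half of \<open>e\<close>.\<close>
  define \<delta> where "\<delta> = e / (8 * (- ln s))"
  have \<delta>: "0 < \<delta>" unfolding \<delta>_def using e ln by (intro divide_pos_pos mult_pos_pos) auto
  have \<delta>_s: "4 * \<delta> * (- ln s) = e / 2" using ln by (simp add: \<delta>_def)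
  show "entropy_rate M T P \<le> ln p + e"
    using entropy_rate_le_approx[OF P \<delta> s] \<delta>_s Cs unfolding C_def by linarith
qed

text \<open>The itineraries of the first symbol are uniformly distributed over all words of length
  \<open>n\<close>, so their entropy is exactly \<open>n * ln p\<close>. This partition attains the
  supremum defining the entropy.\<close>

lemma entropy_rate_first_coordinate:
  "simple_function M (\<lambda>x. fst x 0)" "entropy_rate M T (\<lambda>x. fst x 0) = ln p"
proof -
  interpret prob_space M by (rule prob_M)
  interpret m: prob_space m by (rule prob_m)
  let ?P = "\<lambda>x. fst x 0 :: nat"
  have "?P ` space M \<subseteq> {..<p}" by (auto simp: space_M)
  then show P: "simple_function M ?P"
    by (intro simple_function_countable) (auto intro: finite_subset)
  have it: "itinerary T ?P n x = map (fst x) [0..<n]" for n x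
    by (simp add: itinerary_def fst_Tn)
  have H: "partition_entropy M (itinerary T ?P n) = real n * ln p" for n
  proof -
    note S = simple_function_itinerary[OF P T_measure_preserving, of n]
    have prob: "prob (itinerary T ?P n -` {w} \<inter> space M) = (1 / p) ^ n" if w: "w \<in> level p n" for w
    proof -
      define a where "a i = (if i < n then w ! i else 0)" for i
      have lw: "length w = n" "set w \<subseteq> {..<p}" using w by (auto simp: level_eq)
      have "w ! i < p" if "i < n" for i using subsetD[OF lw(2), of "w ! i"] lw(1) that by simp
      then have a: "a \<in> space (std_space p)" using p_pos by (simp add: a_def space_std)
      let ?C = "{b \<in> space (std_space p). \<forall>i<n. b i = a i}"
      note C = measure_cylinder[OF a, of n]
      have "map b [0..<n] = w \<longleftrightarrow> (\<forall>i<n. b i = a i)" for b :: "nat \<Rightarrow> nat"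
        using lw(1) by (simp add: list_eq_iff_nth_eq a_def)
      then have "x \<in> itinerary T ?P n -` {w} \<inter> space M \<longleftrightarrow> x \<in> ?C \<times> space m" for x
        by (cases x) (simp add: it space_M space_std conj_commute del: map_eq_conv)
      then have "itinerary T ?P n -` {w} \<inter> space M = ?C \<times> space m" by blast
      moreover have "emeasure M (?C \<times> space m) = emeasure (std_space p) ?C * emeasure m (space m)"
        unfolding M_def by (rule m.emeasure_pair_measure_Times[OF C(1) sets.top])
      ultimately show ?thesis
        using C(2) m.emeasure_space_1 by (simp add: measure_def)
    qed
    have image: "itinerary T ?P n ` space M = level p n"
    proof (intro set_eqI iffI)
      fix w assume w: "w \<in> level p n"
      then have "itinerary T ?P n -` {w} \<inter> space M \<noteq> {}"
        using prob[OF w] p_pos by (intro notI) simp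
      then show "w \<in> itinerary T ?P n ` space M" by blast
    qed (auto simp: it level_eq space_M)
    have "partition_entropy M (itinerary T ?P n)
        = (\<Sum>w\<in>level p n. - ((1 / p) ^ n) * ln ((1 / p) ^ n))"
      unfolding partition_entropy_eq_sum[OF S] image by (intro sum.cong refl) (simp add: prob)
    also have "\<dots> = real (p ^ n) * (- ((1 / p) ^ n) * ln ((1 / p) ^ n))"
      by (simp add: card_level)
    also have "\<dots> = - ln ((1 / p) ^ n)" using p_pos by (simp add: power_one_over)
    also have "\<dots> = real n * ln p" using p_pos by (simp add: ln_realpow ln_div)
    finally show ?thesis .
  qed
  have "\<forall>\<^sub>F n in sequentially. partition_entropy M (itinerary T ?P n) / real n = ln p"
    using eventually_gt_at_top[of 0] by eventually_elim (simp add: H)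
  then have "(\<lambda>n. partition_entropy M (itinerary T ?P n) / real n) \<longlonglongrightarrow> ln p"
    by (rule tendsto_eventually)
  with entropy_rate_limit[OF P T_measure_preserving] show "entropy_rate M T ?P = ln p"
    by (rule LIMSEQ_unique)
qed

lemma ks_entropy_eq: "ks_entropy M T = ereal (ln p)"
  unfolding ks_entropy_def
proof (rule antisym)
  show "(SUP P\<in>{P :: _ \<Rightarrow> nat. simple_function M P}. ereal (entropy_rate M T P)) \<le> ereal (ln p)"
    by (intro SUP_least) (simp add: entropy_rate_le)
  show "ereal (ln p) \<le> (SUP P\<in>{P :: _ \<Rightarrow> nat. simple_function M P}. ereal (entropy_rate M T P))"
    using entropy_rate_first_coordinate by (intro SUP_upper2[of "\<lambda>x. fst x 0"]) auto
qed

lemma uniform_endomorphism: "uniform_endomorphism p M T"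
  unfolding uniform_endomorphism_def
  using prob_M T_measure_preserving ks_entropy_eq cond_exp_fiber
  by (auto intro!: AE_I2 card_preimages)

section \<open>The generating tree-adapted function\<close>

lemma ex_dense_sequence: "\<exists>w :: nat \<Rightarrow> 'z. \<forall>z. \<forall>d>0. \<exists>n. dist z (w n) < d"
proof -
  have "\<forall>j :: nat. \<exists>Q :: 'z set. finite Q \<and> (\<forall>z. \<exists>q\<in>Q. dist z q < 1 / real (Suc j))"
    by (intro allI finite_net) simp
  from choice[OF this] obtain Q :: "nat \<Rightarrow> 'z set"
    where Q: "\<forall>j. finite (Q j) \<and> (\<forall>z. \<exists>q\<in>Q j. dist z q < 1 / real (Suc j))" ..
  let ?D = "\<Union>j. Q j"
  have count: "countable ?D" using Q by (intro countable_UN) (auto intro: countable_finite)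
  have ne: "?D \<noteq> {}" using Q by fast
  show ?thesis
  proof (intro exI[of _ "from_nat_into ?D"] allI impI)
    fix z and d :: real assume d: "0 < d"
    obtain j where j: "1 / real (Suc j) < d" using nat_approx_posE[OF d] .
    obtain q where q: "q \<in> Q j" "dist z q < 1 / real (Suc j)" using Q by blast
    then obtain n where "from_nat_into ?D n = q"
      using from_nat_into_surj[OF count, of q] by blast
    with q j have "dist z (from_nat_into ?D n) < d" by simp
    then show "\<exists>n. dist z (from_nat_into ?D n) < d" ..
  qed
qed

text \<open>A scaled Frechet embedding: coordinate 0 records the symbol as
  \<open>i / (p - 1)\<close>, and the others record the distances to a dense sequence divided by
  \<open>C\<close>. For symbols below \<open>p\<close> all entries lie in the unit interval, so
  distances are at most 1, while the copies of symbols 0 and \<open>p - 1\<close> differ by 1 in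
  coordinate 0. As \<open>C\<close> is at least 1, the map does not expand distances in the
  fibre.\<close>

lemma ex_embedding:
  "\<exists>h :: nat \<Rightarrow> 'z \<Rightarrow> (nat \<Rightarrow>\<^sub>C real).
    (\<forall>i<p. \<forall>j<p. \<forall>z w. dist (h i z) (h j w) \<le> 1) \<and>
    (\<forall>i z w. dist (h i z) (h i w) \<le> dist z w) \<and>
    (\<forall>i<p. \<forall>j<p. \<forall>z w. h i z = h j w \<longrightarrow> i = j \<and> z = w) \<and>
    (\<forall>z w. 1 \<le> dist (h 0 z) (h (p - 1) w))"
proof -
  obtain D where D: "\<And>z w :: 'z. dist z w \<le> D" using ex_dist_bound by blast
  define C where "C = max 1 D"
  have C: "1 \<le> C" "\<And>z w :: 'z. dist z w \<le> C" using D by (auto simp: C_def le_max_iff_disj)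
  obtain w :: "nat \<Rightarrow> 'z" where w: "\<And>z d. 0 < d \<Longrightarrow> \<exists>n. dist z (w n) < d"
    using ex_dense_sequence by blast
  define s :: "nat \<Rightarrow> 'z \<Rightarrow> nat \<Rightarrow> real" where
    "s i z = case_nat (real i / real (p - 1)) (\<lambda>n. dist z (w n) / C)" for i z
  have "s i z \<in> bcontfun" for i z
  proof (rule bcontfun_normI)
    show "norm (s i z n) \<le> max (real i / real (p - 1)) 1" for n
      using C by (cases n) (auto simp: s_def le_max_iff_disj)
  qed (simp add: continuous_on_discrete)
  then have app: "apply_bcontfun (Bcontfun (s i z)) = s i z" for i z by (rule Bcontfun_inverse)
  define h where "h i z = Bcontfun (s i z)" for i z
  have diff: "\<bar>dist z (w n) / C - dist z' (w n) / C\<bar> \<le> dist z z'" for z z' n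
  proof -
    have "\<bar>dist z (w n) / C - dist z' (w n) / C\<bar> = \<bar>dist z (w n) - dist z' (w n)\<bar> / C"
      using C by (simp add: diff_divide_distrib[symmetric])
    also have "\<dots> \<le> \<bar>dist z (w n) - dist z' (w n)\<bar> / 1" using C by (intro divide_left_mono) auto
    also have "\<dots> \<le> dist z z'"
      using abs_dist_diff_le[of z "w n" z'] by (simp add: dist_commute[of "w n"])
    finally show ?thesis .
  qed
  show ?thesis
  proof (intro exI[of _ h] conjI allI impI)
    fix i j z z' assume ij: "i < p" "j < p"
    have unit: "0 \<le> s i z n" "s i z n \<le> 1" if "i < p" for i z n
      using C that by (cases n; simp add: s_def divide_le_eq)+
    have "dist (s i z n) (s j z' n) \<le> 1" for n
      using unit[OF ij(1), of z n] unit[OF ij(2), of z' n] by (simp add: dist_real_def)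
    then show "dist (h i z) (h j z') \<le> 1" by (intro dist_bound) (simp add: h_def app)
  next
    fix i z z'
    have "dist (s i z n) (s i z' n) \<le> dist z z'" for n
      using diff by (cases n) (auto simp: s_def dist_real_def)
    then show "dist (h i z) (h i z') \<le> dist z z'" by (intro dist_bound) (simp add: h_def app)
  next
    fix i j z z' assume ij: "i < p" "j < p" and "h i z = h j z'"
    then have eq: "s i z = s j z'" by (metis app h_def)
    show "i = j" using fun_cong[OF eq, of 0] p_ge_2 by (simp add: s_def)
    have "dist z z' \<le> 0 + d" if "0 < d" for d
    proof -
      have "\<exists>n. dist z (w n) < d / 2" using that by (intro w) simp
      then obtain n where n: "dist z (w n) < d / 2" ..
      have "dist z (w n) = dist z' (w n)" using fun_cong[OF eq, of "Suc n"] C by (simp add: s_def)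
      with n show ?thesis using dist_triangle2[of z z' "w n"] by simp
    qed
    then have "dist z z' \<le> 0" by (rule field_le_epsilon)
    then show "z = z'" by simp
  next
    fix z z'
    have "1 = dist (s 0 z 0) (s (p - 1) z' 0)" using p_ge_2 by (simp add: s_def dist_real_def)
    also have "\<dots> \<le> dist (h 0 z) (h (p - 1) z')"
      using dist_bounded[of "h 0 z" 0 "h (p - 1) z'"] by (simp add: h_def app)
    finally show "1 \<le> dist (h 0 z) (h (p - 1) z')" .
  qed
qed

lemma tree_vwB_of_weakly_mixing:
  assumes wm: "weakly_mixing M T"
  shows "tree_vwB p M T"
proof -
  obtain h :: "nat \<Rightarrow> 'z \<Rightarrow> (nat \<Rightarrow>\<^sub>C real)" where
    h: "\<forall>i<p. \<forall>j<p. \<forall>z w. dist (h i z) (h j w) \<le> 1"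
      "\<forall>i z w. dist (h i z) (h i w) \<le> dist z w"
      "\<forall>i<p. \<forall>j<p. \<forall>z w. h i z = h j w \<longrightarrow> i = j \<and> z = w"
      "\<forall>z w. 1 \<le> dist (h 0 z) (h (p - 1) w)"
    using ex_embedding by (elim exE conjE)
  note h1 = h(1)[rule_format] and hL = h(2)[rule_format] and inj = h(3)[rule_format]
    and far = h(4)[rule_format]
  have cont: "continuous_on A (h i)" for i A
    unfolding continuous_on_iff
  proof (intro ballI allI impI)
    fix z and e :: real assume "0 < e"
    then show "\<exists>d>0. \<forall>z'\<in>A. dist z' z < d \<longrightarrow> dist (h i z') (h i z) < e"
      by (intro exI[of _ e]) (auto intro: le_less_trans[OF hL])
  qed
  define g where "g x = h (fst x 0) (snd x)" for x :: "(nat \<Rightarrow> nat) \<times> 'z"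
  define R where "R = (\<Union>i<p. h i ` UNIV)"
  have closed_image: "closed (\<Union>i\<in>I. h i ` C)" if "finite I" "closed C" for I C
  proof -
    have "compact C" using compact_Int_closed[OF compact_UNIV that(2)] by simp
    then show ?thesis using that
      by (intro closed_UN ballI compact_imp_closed compact_continuous_image cont)
  qed
  have compact_R: "compact R"
    unfolding R_def by (intro compact_UN compact_continuous_image cont compact_UNIV) auto
  have "diameter R = 1"
  proof (rule antisym)
    show "diameter R \<le> 1"
    proof (rule diameter_le)
      show "R \<noteq> {} \<or> 0 \<le> (1 :: real)" by simp
      fix x y assume "x \<in> R" "y \<in> R"
      then show "norm (x - y) \<le> 1" using h1 by (auto simp: R_def dist_norm)
    qed
    have "h 0 undefined \<in> R" "h (p - 1) undefined \<in> R"
      unfolding R_def using p_ge_2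
      by (intro UN_I[of 0] UN_I[of "p - 1"] rangeI; simp)+
    from order_trans[OF far diameter_bounded_bound[OF compact_imp_bounded[OF compact_R] this]]
    show "1 \<le> diameter R" .
  qed
  moreover have g_meas: "g \<in> borel_measurable M"
    unfolding g_def
    by (rule measurable_compose_countable)
       (intro measurable_compose[OF snd_borel_measurable] borel_measurable_continuous_onI cont, measurable)
  moreover have "g \<in> space M \<rightarrow> R"
  proof
    fix x assume "x \<in> space M"
    then show "g x \<in> R"
      unfolding g_def R_def by (intro UN_I[of "fst x 0"] rangeI) (simp add: space_M)
  qed
  moreover have "tree_adapted p M T K g"
    unfolding tree_adapted_def
  proof (rule AE_I2, intro ballI allI impI)
    fix x v i j assume x: "x \<in> space M" and v: "v \<in> words p" and ij: "i < p" "j < p" "i \<noteq> j"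
    \<comment> \<open>The last letter of a word is the first symbol of the endpoint of its branch,
      so siblings are sent to different copies of the fibre.\<close>
    have "tree_name T K g x (v @ [l]) = h l (snd (S l (branch S v x)))" if "l < p" for l
    proof -
      have "tree_name T K g x (v @ [l]) = g (branch S (v @ [l]) x)"
        unfolding tree_name_def using v that x by (subst branch_partial_inverse) simp_all
      then show ?thesis by (simp add: g_def S_def std_inverse_def)
    qed
    with ij inj show "tree_name T K g x (v @ [i]) \<noteq> tree_name T K g x (v @ [j])" by metis
  qed
  moreover have "generating M T g"
    unfolding generating_def
  proof
    fix A assume A: "A \<in> sets M"
    let ?G = "{(\<lambda>x. g ((T ^^ i) x)) -` C \<inter> space M | i C. C \<in> sets borel}"
    define N where "N = sigma (space M) ?G"
    have N: "space N = space M" "sets N = sigma_sets (space M) ?G"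
      unfolding N_def by (auto simp: space_measure_of_conv intro!: sets_measure_of)
    have gT: "(\<lambda>x. g ((T ^^ i) x)) \<in> borel_measurable N" for i
    proof (rule measurableI)
      fix C :: "(nat \<Rightarrow>\<^sub>C real) set" assume "C \<in> sets borel"
      then show "(\<lambda>x. g ((T ^^ i) x)) -` C \<inter> space N \<in> sets N"
        unfolding N by (intro sigma_sets.Basic) blast
    qed simp
    \<comment> \<open>By injectivity on pairs this set is the pullback of a finite union of compact
      images. With the whole fibre for \<open>C\<close> it yields the \<open>i\<close>-th symbol,
      and with \<open>i = 0\<close> and all symbols it yields the fibre coordinate of
      \<open>x\<close>.\<close>
    have pull: "{x \<in> space M. fst x i \<in> I \<and> snd ((T ^^ i) x) \<in> C} \<in> sets N"
      if C: "closed C" and I: "I \<subseteq> {..<p}" for i I C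
    proof -
      have "{x \<in> space M. fst x i \<in> I \<and> snd ((T ^^ i) x) \<in> C}
          = (\<lambda>x. g ((T ^^ i) x)) -` (\<Union>a\<in>I. h a ` C) \<inter> space N"
      proof (intro set_eqI iffI)
        fix x assume "x \<in> (\<lambda>x. g ((T ^^ i) x)) -` (\<Union>a\<in>I. h a ` C) \<inter> space N"
        then obtain a z where x: "x \<in> space M" and a: "a \<in> I" "z \<in> C"
          and eq: "h (fst x i) (snd ((T ^^ i) x)) = h a z"
          by (auto simp: g_def fst_Tn N)
        have "fst x i < p" "a < p" using x a I by (auto simp: space_M)
        from inj[OF this eq] show "x \<in> {x \<in> space M. fst x i \<in> I \<and> snd ((T ^^ i) x) \<in> C}"
          using x a by simp
      qed (auto simp: g_def fst_Tn N)
      also have "\<dots> \<in> sets N"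
        using I C finite_subset[OF I] by (intro measurable_sets[OF gT] borel_closed closed_image) auto
      finally show ?thesis .
    qed
    have "(\<lambda>x. fst x) \<in> N \<rightarrow>\<^sub>M std_space p"
    proof (rule measurable_into_std)
      fix i
      have "{x \<in> space M. fst x i = a} \<in> sets N" for a
        using pull[of UNIV "{a} \<inter> {..<p}" i] by (simp add: space_M) (smt (verit) Collect_cong)
      then show "(\<lambda>x. fst x i) \<in> N \<rightarrow>\<^sub>M count_space UNIV"
        by (auto simp: measurable_count_space_eq2_countable N(1) vimage_def Int_def conj_commute)
    qed (simp add: N(1) fst_space)
    moreover have "(\<lambda>x. snd x) \<in> N \<rightarrow>\<^sub>M m"
    proof -
      have "{x \<in> space M. snd x \<in> C} \<in> sets N" if "closed C" for C
        using pull[OF that, of "{..<p}" 0] by (simp add: space_M cong: conj_cong)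
      then have "(\<lambda>x. snd x) \<in> N \<rightarrow>\<^sub>M borel"
        unfolding borel_eq_closed
        by (intro measurable_measure_of) (auto simp: N(1) vimage_def Int_def conj_commute)
      then show ?thesis by (simp add: measurable_cong_sets[OF refl sets_m])
    qed
    ultimately have "(\<lambda>x. (fst x, snd x)) \<in> N \<rightarrow>\<^sub>M M"
      unfolding M_def by (rule measurable_Pair)
    \<comment> \<open>Measurability of the identity puts every set of \<open>M\<close> into the
      generated sigma-algebra exactly, so \<open>A\<close> itself serves as the approximating
      set.\<close>
    from measurable_sets[OF this A] have "A \<inter> space M \<in> sets N" by (simp add: N(1))
    then have "A \<in> sigma_sets (space M) ?G"
      using sets.sets_into_space[OF A] by (simp add: Int_absorb2 N(2))
    then show "\<exists>A'\<in>sigma_sets (space M) ?G. (A - A') \<union> (A' - A) \<in> null_sets M"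
      by (intro bexI[of _ A]) auto
  qed
  moreover have "tree_vwB_with p M T K g"
  proof (rule tree_vwB_with_close[OF wm])
    show "dist (g x) (g y) \<le> 1" if "x \<in> space M" "y \<in> space M" for x y
      using that by (auto simp: g_def space_M intro: h1)
    show "dist (g x) (g y) \<le> dist (snd x) (snd y)" if "fst x 0 = fst y 0" for x y
      using that hL by (simp add: g_def)
  qed
  ultimately show ?thesis
    unfolding tree_vwB_def using uniform_endomorphism preimage_partition compact_R by blast
qed

end

theorem theorem6p4:
  fixes p :: nat
    and m :: "'z::metric_space measure"
    and f :: "(nat \<Rightarrow> nat) \<Rightarrow> 'z \<Rightarrow> 'z"
  assumes "p \<ge> 2"
    and "compact (UNIV :: 'z set)"
    and "\<forall>z w :: 'z. \<exists>\<phi>\<in>isometries. \<phi> z = w"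
    and "prob_space m"
    and "sets m = sets borel"
    and "\<forall>\<phi>\<in>isometries. distr m m \<phi> = m"
    and "f \<in> space (std_space p) \<rightarrow> isometries"
    and "summable_cocycle p f"
    and "weakly_mixing (std_space p \<Otimes>\<^sub>M m) (cocycle_extension f)"
  shows "tree_vwB p (std_space p \<Otimes>\<^sub>M m) (cocycle_extension f)"
proof -
  interpret summable_extension p m f by (rule summable_extension.intro) (rule assms)+
  show ?thesis using tree_vwB_of_weakly_mixing assms(9) unfolding M_def T_def by simp
qed

end
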